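(* Let $K\geq 8$ be an integer and let $a_1,a_2,\ldots,a_K$ be positive integers whose square-free parts are all distinct. Let $m_1,\ldots,m_K$ be nonzero integers, and put $$\Lambda:=\bigg|\sum_{n\leq K}m_n\sqrt{a_n}\bigg|.$$ Then $$\Lambda\geq e^{(2^{K-1}-1)/K}\bigg(\frac{1}{1-2^{1-K}}\sum_{n\leq K}m_n^2a_n\bigg)^{-(2^{K-1}-1)/2}.$$ In particular, $$\Lambda\geq C_K\,e^{(2^{K-1}-1)/K}\bigg(\max_{n\leq K}|m_n|\sqrt{a_n}\cdot\sqrt{K}\bigg)^{-(2^{K-1}-1)},$$ where $C_K:=(1-2^{1-K})^{(2^{K-1}-1)/2}>e^{-1/2}$. Moreover, $C_K=e^{-1/2}+O(2^{-K})$, with an absolute implied constant.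
   Context: Every positive integer $a$ can be decomposed as $a=c^2d$ with $c,d$ positive integers and $d$ square-free; $d$ is called the square-free part of $a$. The index $n$ ranges over the integers $1\leq n\leq K$. *)

theory Defs
  imports "HOL-Analysis.Analysis" "HOL-Computational_Algebra.Squarefree"
begin

definition Lambda :: "nat \<Rightarrow> (nat \<Rightarrow> int) \<Rightarrow> (nat \<Rightarrow> nat) \<Rightarrow> real" where
  "Lambda K m a = \<bar>\<Sum>n=1..K. real_of_int (m n) * sqrt (real (a n))\<bar>"

text \<open>
  The exponents \<open>(2 ^ (K - 1) - 1) / 2\<close> are half-integers, hence \<open>powr\<close>; the bases
  occurring with such exponents are positive as soon as \<open>K \<ge> 2\<close>.
\<close>

definition C_const :: "nat \<Rightarrow> real" where
  "C_const K = (1 - 2 powr (1 - real K)) powr ((2 ^ (K - 1) - 1) / 2)"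

end

theory Submission
  imports Defs "HOL-Library.Sublist"
begin

text \<open>
  Write \<open>x\<^sub>n = m\<^sub>n \<surd>a\<^sub>n\<close>, \<open>N = 2\<^sup>K\<^sup>-\<^sup>1 - 1\<close> and
  \<open>Q = \<Sum> x\<^sub>n\<^sup>2\<close>.  The number \<open>\<Lambda> = \<bar>\<Sum> x\<^sub>n\<bar>\<close> is compared with its conjugates, the
  signed sums \<open>s\<^sub>I\<close> obtained by keeping the sign of \<open>x\<^sub>n\<close> for \<open>n \<in> I\<close> and flipping it
  for \<open>n \<notin> I\<close>.  The product of all \<open>2\<^sup>K\<close> of them is an integer, since it is an integer
  polynomial in the integers \<open>x\<^sub>n\<^sup>2\<close> (\<open>prod_signed_sums_in_Ints\<close>), and it is nonzero,
  since square roots of integers with distinct square-free parts are linearly independent over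
  the rationals (\<open>sqrt_distinct_squarefree_parts_independent\<close>).  Its absolute value is therefore
  at least 1.  The two factors with \<open>I = {1..K}\<close> and \<open>I = {}\<close> have absolute value \<open>\<Lambda>\<close>,
  so a lower bound for \<open>\<Lambda>\<close> amounts to an upper bound for the product of the others.

  Since the mean of \<open>s\<^sub>I\<^sup>2\<close> is \<open>Q\<close>, the inequality between arithmetic and geometric means gives
  the stated bound up to the factor \<open>exp (N / K)\<close>.  To gain this factor, the mean of
  \<open>ln (s\<^sub>I\<^sup>2 / Q)\<close> must be at most about \<open>-2 / K\<close> (\<open>log_sum_le\<close>).  Here \<open>\<Lambda>\<close> may be assumed tiny, as the
  claimed bound itself is tiny (\<open>bound_is_tiny\<close>).  Two regimes occur.

  \<^item> Some \<open>x\<^sub>k\<^sup>2\<close> is at least \<open>Q / 2\<close> (\<open>dominant_log_sum\<close>).  Flipping the sign of \<open>x\<^sub>k\<close> pairs the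
    signed sums; a pair has product \<open>T\<^sup>2 - x\<^sub>k\<^sup>2\<close>, with \<open>T\<close> a signed sum of the other terms.
    With \<open>q\<close> the share of the other terms in \<open>Q\<close>, the mean of \<open>(T\<^sup>2 - x\<^sub>k\<^sup>2)\<^sup>2\<close> is at most
    \<open>(1 - 4 q + 6 q\<^sup>2) Q\<^sup>2\<close>.  As \<open>\<Lambda>\<close> is tiny, the other terms must cancel \<open>x\<^sub>k\<close>, and the
    Cauchy-Schwarz inequality forces \<open>q \<ge> 1 / K\<close> up to a negligible error.  The extreme case is
    \<open>x\<^sub>k = - (K - 1) t\<close> with all other terms equal to \<open>t\<close>; there the gain is \<open>2 / K\<close> to leading
    order, so this is where \<open>exp (N / K)\<close> comes from.

  \<^item> Every \<open>x\<^sub>n\<^sup>2\<close> is at most \<open>Q / 2\<close> (\<open>balanced_log_sum\<close>).  Then the signed sums are spread out,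
    and the mean of the logarithm is below \<open>-1/4 \<le> -2 / K\<close>.  This is seen by bounding \<open>ln\<close> from above
    by a cubic (\<open>ln_le_cubic\<close>), whose mean is given by the moments of order 2, 4 and 6.

  The second bound follows from the first by \<open>Q \<le> K max x\<^sub>n\<^sup>2\<close>.  The assertions about \<open>C_const\<close> come
  from \<open>1 - 2\<^sup>1\<^sup>-\<^sup>K = 1 / (1 + 1 / N)\<close>, that is \<open>C_const K = (1 + 1 / N) powr (- N / 2)\<close>, and
  \<open>1 / N - 1 / N\<^sup>2 \<le> ln (1 + 1 / N) < 1 / N\<close>.
\<close>

section \<open>Signed sums and their moments\<close>

definition signed_sum :: "('a \<Rightarrow> real) \<Rightarrow> 'a set \<Rightarrow> 'a set \<Rightarrow> real" where
  "signed_sum x A I = (\<Sum>i\<in>A. if i \<in> I then x i else - x i)"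

lemma signed_sum_full: "signed_sum x A A = sum x A"
  by (simp add: signed_sum_def)

lemma signed_sum_none: "signed_sum x A {} = - sum x A"
  by (simp add: signed_sum_def sum_negf)

lemma signed_sum_insert_in:
  assumes "finite B" "k \<notin> B"
  shows "signed_sum x (insert k B) (insert k J) = x k + signed_sum x B J"
proof -
  have "(\<Sum>i\<in>B. if i = k \<or> i \<in> J then x i else - x i) = (\<Sum>i\<in>B. if i \<in> J then x i else - x i)"
    using assms by (intro sum.cong) auto
  then show ?thesis using assms by (simp add: signed_sum_def)
qed

lemma signed_sum_insert_out:
  assumes "finite B" "k \<notin> B" "J \<subseteq> B"
  shows "signed_sum x (insert k B) J = - x k + signed_sum x B J"
  using assms by (auto simp: signed_sum_def)

text \<open>
  Splitting off one index doubles the signed sums.  The moment formulas and the pairing by the sign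
  of a dominant term both rest on this identity, its product version serves the integrality.
\<close>

lemma sum_signed_insert:
  assumes "finite B" "k \<notin> B"
  shows "(\<Sum>I\<in>Pow (insert k B). f (signed_sum x (insert k B) I)) =
         (\<Sum>J\<in>Pow B. f (x k + signed_sum x B J) + f (- x k + signed_sum x B J))"
proof -
  have inj: "inj_on (insert k) (Pow B)"
    using assms(2) by (auto simp: inj_on_def)
  have "(\<Sum>I\<in>Pow (insert k B). f (signed_sum x (insert k B) I)) =
      (\<Sum>J\<in>Pow B. f (signed_sum x (insert k B) J)) + (\<Sum>J\<in>insert k ` Pow B. f (signed_sum x (insert k B) J))"
    unfolding Pow_insert using assms by (intro sum.union_disjoint) auto
  also have "\<dots> = (\<Sum>J\<in>Pow B. f (- x k + signed_sum x B J)) + (\<Sum>J\<in>Pow B. f (x k + signed_sum x B J))"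
    using assms by (simp add: sum.reindex[OF inj] signed_sum_insert_in signed_sum_insert_out)
  finally show ?thesis by (simp add: sum.distrib add.commute)
qed

lemma prod_signed_insert:
  fixes f :: "real \<Rightarrow> 'b::comm_monoid_mult"
  assumes "finite B" "k \<notin> B"
  shows "(\<Prod>I\<in>Pow (insert k B). f (signed_sum x (insert k B) I)) =
         (\<Prod>J\<in>Pow B. f (x k + signed_sum x B J) * f (- x k + signed_sum x B J))"
proof -
  have inj: "inj_on (insert k) (Pow B)"
    using assms(2) by (auto simp: inj_on_def)
  have "(\<Prod>I\<in>Pow (insert k B). f (signed_sum x (insert k B) I)) =
      (\<Prod>J\<in>Pow B. f (signed_sum x (insert k B) J)) * (\<Prod>J\<in>insert k ` Pow B. f (signed_sum x (insert k B) J))"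
    unfolding Pow_insert using assms by (intro prod.union_disjoint) auto
  also have "\<dots> = (\<Prod>J\<in>Pow B. f (- x k + signed_sum x B J)) * (\<Prod>J\<in>Pow B. f (x k + signed_sum x B J))"
    using assms by (simp add: prod.reindex[OF inj] signed_sum_insert_in signed_sum_insert_out)
  finally show ?thesis by (simp add: prod.distrib mult.commute)
qed

lemma signed_sum_second_moment:
  assumes "finite A"
  shows "(\<Sum>I\<in>Pow A. (signed_sum x A I)\<^sup>2) = 2 ^ card A * (\<Sum>i\<in>A. (x i)\<^sup>2)"
  using assms
proof (induction A rule: finite_induct)
  case empty
  then show ?case by (simp add: signed_sum_def)
next
  case (insert k B)
  have "(\<Sum>I\<in>Pow (insert k B). (signed_sum x (insert k B) I)\<^sup>2)
      = (\<Sum>J\<in>Pow B. 2 * (x k)\<^sup>2 + 2 * (signed_sum x B J)\<^sup>2)"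
    using insert by (subst sum_signed_insert) (auto intro!: sum.cong simp: power2_eq_square algebra_simps)
  then show ?case
    using insert by (simp add: sum.distrib flip: sum_distrib_left) (simp add: card_Pow algebra_simps)
qed

text \<open>
  The moments are those of a sum of independent random signs with coefficients \<open>x i\<close>: the
  Gaussian values 3 and 15, corrected by the fourth and sixth power sums of the coefficients.  The
  recursion adds one coefficient at a time, and odd moments cancel.
\<close>

lemma signed_sum_fourth_moment:
  assumes "finite A"
  shows "(\<Sum>I\<in>Pow A. (signed_sum x A I) ^ 4) =
    2 ^ card A * (3 * (\<Sum>i\<in>A. (x i)\<^sup>2)\<^sup>2 - 2 * (\<Sum>i\<in>A. (x i) ^ 4))"
  using assms
proof (induction A rule: finite_induct)
  case empty
  then show ?case by (simp add: signed_sum_def)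
next
  case (insert k B)
  have "(\<Sum>I\<in>Pow (insert k B). (signed_sum x (insert k B) I) ^ 4)
      = (\<Sum>J\<in>Pow B. 2 * (x k) ^ 4 + 12 * (x k)\<^sup>2 * (signed_sum x B J)\<^sup>2 + 2 * (signed_sum x B J) ^ 4)"
    using insert by (subst sum_signed_insert)
      (auto intro!: sum.cong simp: power2_eq_square power4_eq_xxxx algebra_simps)
  also have "\<dots> = 2 ^ card B * (2 * (x k) ^ 4) + 12 * (x k)\<^sup>2 * (2 ^ card B * (\<Sum>i\<in>B. (x i)\<^sup>2)) +
      2 * (2 ^ card B * (3 * (\<Sum>i\<in>B. (x i)\<^sup>2)\<^sup>2 - 2 * (\<Sum>i\<in>B. (x i) ^ 4)))"
    using insert by (simp add: sum.distrib signed_sum_second_moment card_Pow flip: sum_distrib_left)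
  finally show ?case
    using insert by (simp add: power2_eq_square power4_eq_xxxx algebra_simps)
qed

lemma signed_sum_sixth_moment:
  assumes "finite A"
  shows "(\<Sum>I\<in>Pow A. (signed_sum x A I) ^ 6) =
    2 ^ card A * (15 * (\<Sum>i\<in>A. (x i)\<^sup>2) ^ 3
      - 30 * (\<Sum>i\<in>A. (x i)\<^sup>2) * (\<Sum>i\<in>A. (x i) ^ 4) + 16 * (\<Sum>i\<in>A. (x i) ^ 6))"
  using assms
proof (induction A rule: finite_induct)
  case empty
  then show ?case by (simp add: signed_sum_def)
next
  case (insert k B)
  have "(y + t) ^ 6 + (- y + t) ^ 6 = 2 * y ^ 6 + 30 * y ^ 4 * t\<^sup>2 + 30 * y\<^sup>2 * t ^ 4 + 2 * t ^ 6" for y t :: real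
    by (simp add: power2_eq_square eval_nat_numeral algebra_simps)
  then have "(\<Sum>I\<in>Pow (insert k B). (signed_sum x (insert k B) I) ^ 6)
      = (\<Sum>J\<in>Pow B. 2 * (x k) ^ 6 + 30 * (x k) ^ 4 * (signed_sum x B J)\<^sup>2
          + 30 * (x k)\<^sup>2 * (signed_sum x B J) ^ 4 + 2 * (signed_sum x B J) ^ 6)"
    using insert by (subst sum_signed_insert) (auto intro!: sum.cong)
  also have "\<dots> = 2 ^ card B * (2 * (x k) ^ 6) + 30 * (x k) ^ 4 * (2 ^ card B * (\<Sum>i\<in>B. (x i)\<^sup>2)) +
      30 * (x k)\<^sup>2 * (2 ^ card B * (3 * (\<Sum>i\<in>B. (x i)\<^sup>2)\<^sup>2 - 2 * (\<Sum>i\<in>B. (x i) ^ 4))) +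
      2 * (2 ^ card B * (15 * (\<Sum>i\<in>B. (x i)\<^sup>2) ^ 3
      - 30 * (\<Sum>i\<in>B. (x i)\<^sup>2) * (\<Sum>i\<in>B. (x i) ^ 4) + 16 * (\<Sum>i\<in>B. (x i) ^ 6)))"
    using insert by (simp add: sum.distrib signed_sum_second_moment signed_sum_fourth_moment card_Pow
        flip: sum_distrib_left)
  also have "\<dots> = 2 ^ card B * (2 * (15 * ((x k)\<^sup>2 + (\<Sum>i\<in>B. (x i)\<^sup>2)) ^ 3
      - 30 * ((x k)\<^sup>2 + (\<Sum>i\<in>B. (x i)\<^sup>2)) * ((x k) ^ 4 + (\<Sum>i\<in>B. (x i) ^ 4))
      + 16 * ((x k) ^ 6 + (\<Sum>i\<in>B. (x i) ^ 6))))"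
    by algebra
  finally show ?case
    using insert by simp
qed

section \<open>The product of all signed sums is an integer\<close>

lemma map_poly_of_int_add:
  "map_poly real_of_int (p + q) = map_poly real_of_int p + map_poly real_of_int q"
  by (intro poly_eqI) (simp add: coeff_map_poly)

lemma map_poly_of_int_smult:
  "map_poly real_of_int (smult k p) = smult (real_of_int k) (map_poly real_of_int p)"
  by (intro poly_eqI) (simp add: coeff_map_poly)

lemma map_poly_of_int_diff:
  "map_poly real_of_int (p - q) = map_poly real_of_int p - map_poly real_of_int q"
  by (intro poly_eqI) (simp add: coeff_map_poly)

lemma map_poly_of_int_mult:
  "map_poly real_of_int (p * q) = map_poly real_of_int p * map_poly real_of_int q"
  by (intro poly_eqI) (simp add: coeff_map_poly coeff_mult)

text \<open>
  Expand \<open>p (x + y)\<close> in powers of \<open>x\<close> and use that even powers of \<open>x\<close> are integers.  The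
  polynomials \<open>a\<close> and \<open>b\<close> depend only on \<open>x\<^sup>2 = k\<close>, hence serve \<open>- x\<close> as well.
\<close>

lemma int_poly_shift:
  fixes p :: "int poly"
  shows "\<exists>a b. \<forall>x y :: real. x\<^sup>2 = of_int k \<longrightarrow>
     poly (map_poly of_int p) (x + y) =
       poly (map_poly of_int a) y + x * poly (map_poly of_int b) y"
proof (induction p)
  case 0
  show ?case by (intro exI[of _ 0]) simp
next
  case (pCons c p)
  then obtain a b where ab: "\<And>x y :: real. x\<^sup>2 = of_int k \<Longrightarrow>
     poly (map_poly of_int p) (x + y) =
       poly (map_poly of_int a) y + x * poly (map_poly of_int b) y"
    by blast
  have "poly (map_poly of_int (pCons c p)) (x + y) =
     poly (map_poly of_int (pCons c a + smult k b)) y + x * poly (map_poly of_int (a + pCons 0 b)) y"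
    if x: "x\<^sup>2 = of_int k" for x y :: real
  proof -
    have "x * (x * t) = of_int k * t" for t :: real
      using x by (simp add: power2_eq_square flip: mult.assoc)
    then show ?thesis
      using ab[OF x, of y]
      by (simp add: map_poly_pCons map_poly_of_int_add map_poly_of_int_smult algebra_simps)
  qed
  then show ?case by blast
qed

text \<open>
  The variable \<open>y\<close> makes the induction work: adjoining \<open>x k\<close> replaces \<open>p y\<close> by
  \<open>p (x k + y) * p (- x k + y)\<close>, which is \<open>a\<^sup>2 - (x k)\<^sup>2 b\<^sup>2\<close> in the notation of the previous
  lemma.
\<close>

lemma prod_signed_sums_int_poly:
  fixes x :: "'a \<Rightarrow> real"
  assumes "finite A" "\<And>i. i \<in> A \<Longrightarrow> (x i)\<^sup>2 \<in> \<int>"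
  shows "\<exists>p :: int poly. \<forall>y. (\<Prod>I\<in>Pow A. y + signed_sum x A I) = poly (map_poly of_int p) y"
  using assms
proof (induction A rule: finite_induct)
  case empty
  show ?case by (intro exI[of _ "[:0, 1:]"]) (simp add: signed_sum_def map_poly_pCons)
next
  case (insert k B)
  then obtain p :: "int poly"
    where p: "\<And>y. (\<Prod>J\<in>Pow B. y + signed_sum x B J) = poly (map_poly of_int p) y"
    by auto
  obtain c where c: "(x k)\<^sup>2 = of_int c"
    using insert.prems by (auto elim: Ints_cases)
  obtain a b where ab: "\<And>t y :: real. t\<^sup>2 = of_int c \<Longrightarrow>
     poly (map_poly of_int p) (t + y) =
       poly (map_poly of_int a) y + t * poly (map_poly of_int b) y"
    using int_poly_shift[of c p] by blast
  have "(\<Prod>I\<in>Pow (insert k B). y + signed_sum x (insert k B) I)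
      = poly (map_poly of_int (a * a - smult c (b * b))) y" for y
  proof -
    have "(\<Prod>I\<in>Pow (insert k B). y + signed_sum x (insert k B) I)
        = (\<Prod>J\<in>Pow B. (x k + y) + signed_sum x B J) * (\<Prod>J\<in>Pow B. (- x k + y) + signed_sum x B J)"
      unfolding prod_signed_insert[OF insert.hyps(1,2), of "\<lambda>s. y + s"] prod.distrib
      by (simp only: add.assoc add.left_commute)
    also have "\<dots> = (poly (map_poly of_int a) y)\<^sup>2 - (x k)\<^sup>2 * (poly (map_poly of_int b) y)\<^sup>2"
    proof -
      have "(- x k)\<^sup>2 = of_int c" using c by simp
      from ab[OF c, of y] ab[OF this, of y] show ?thesis
        unfolding p by (simp only:) (simp add: power2_eq_square algebra_simps)
    qed
    finally show ?thesis
      by (simp add: map_poly_of_int_diff map_poly_of_int_smult map_poly_of_int_mult flip: c)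
        (simp add: power2_eq_square)
  qed
  then show ?case by blast
qed

lemma prod_signed_sums_in_Ints:
  fixes x :: "'a \<Rightarrow> real"
  assumes "finite A" "\<And>i. i \<in> A \<Longrightarrow> (x i)\<^sup>2 \<in> \<int>"
  shows "(\<Prod>I\<in>Pow A. signed_sum x A I) \<in> \<int>"
proof -
  obtain p :: "int poly"
    where "\<And>y. (\<Prod>I\<in>Pow A. y + signed_sum x A I) = poly (map_poly of_int p) y"
    using prod_signed_sums_int_poly[of A x] assms by auto
  from this[of 0] show ?thesis
    by (simp add: poly_0_coeff_0 coeff_map_poly)
qed

section \<open>Linear independence of square roots\<close>

text \<open>
  The field generated over the rationals by the square roots of the listed numbers, as a tower of
  extensions of degree at most 2.
\<close>

fun sqrt_tower :: "nat list \<Rightarrow> real set" where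
  "sqrt_tower [] = \<rat>"
| "sqrt_tower (p # ps) = {a + b * sqrt p | a b. a \<in> sqrt_tower ps \<and> b \<in> sqrt_tower ps}"

lemma sqrt_tower_ConsI:
  "a \<in> sqrt_tower ps \<Longrightarrow> b \<in> sqrt_tower ps \<Longrightarrow> a + b * sqrt p \<in> sqrt_tower (p # ps)"
  by auto

lemma sqrt_tower_Rats: "q \<in> \<rat> \<Longrightarrow> q \<in> sqrt_tower ps"
proof (induction ps arbitrary: q)
  case (Cons p ps)
  show ?case using sqrt_tower_ConsI[of q ps 0 p] Cons by simp
qed simp

lemma sqrt_tower_of_nat: "real n \<in> sqrt_tower ps"
  by (rule sqrt_tower_Rats) simp

lemma sqrt_tower_Cons_mono: "z \<in> sqrt_tower ps \<Longrightarrow> z \<in> sqrt_tower (p # ps)"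
  using sqrt_tower_ConsI[of z ps 0 p] sqrt_tower_Rats[of 0 ps] by simp

lemma sqrt_tower_add:
  "y \<in> sqrt_tower ps \<Longrightarrow> z \<in> sqrt_tower ps \<Longrightarrow> y + z \<in> sqrt_tower ps"
proof (induction ps arbitrary: y z)
  case (Cons p ps)
  then obtain a b c d where "y = a + b * sqrt p" "z = c + d * sqrt p"
    and in_ps: "a \<in> sqrt_tower ps" "b \<in> sqrt_tower ps" "c \<in> sqrt_tower ps" "d \<in> sqrt_tower ps"
    by auto
  then have "y + z = (a + c) + (b + d) * sqrt p" by (simp add: algebra_simps)
  then show ?case using Cons.IH in_ps by auto
qed simp

lemma sqrt_tower_mult:
  "y \<in> sqrt_tower ps \<Longrightarrow> z \<in> sqrt_tower ps \<Longrightarrow> y * z \<in> sqrt_tower ps"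
proof (induction ps arbitrary: y z)
  case (Cons p ps)
  then obtain a b c d where "y = a + b * sqrt p" "z = c + d * sqrt p"
    and in_ps: "a \<in> sqrt_tower ps" "b \<in> sqrt_tower ps" "c \<in> sqrt_tower ps" "d \<in> sqrt_tower ps"
    by auto
  then have "y * z = (a * c + b * d * p) + (a * d + b * c) * sqrt p"
    by (simp add: algebra_simps flip: real_sqrt_mult)
  moreover have "a * c + b * d * p \<in> sqrt_tower ps" "a * d + b * c \<in> sqrt_tower ps"
    using Cons.IH in_ps by (auto intro!: sqrt_tower_add sqrt_tower_of_nat)
  ultimately show ?case by auto
qed simp

lemma sqrt_tower_uminus: "z \<in> sqrt_tower ps \<Longrightarrow> - z \<in> sqrt_tower ps"
  using sqrt_tower_mult[of "-1" ps z] by (simp add: sqrt_tower_Rats)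

lemma sqrt_tower_diff:
  "y \<in> sqrt_tower ps \<Longrightarrow> z \<in> sqrt_tower ps \<Longrightarrow> y - z \<in> sqrt_tower ps"
  using sqrt_tower_add[of y ps "- z"] by (simp add: sqrt_tower_uminus)

lemma sqrt_tower_inverse: "z \<in> sqrt_tower ps \<Longrightarrow> inverse z \<in> sqrt_tower ps"
proof (induction ps arbitrary: z)
  case (Cons p ps)
  then obtain a b where z: "z = a + b * sqrt p"
    and ab: "a \<in> sqrt_tower ps" "b \<in> sqrt_tower ps"
    by auto
  show ?case
  proof (cases "a - b * sqrt p = 0")
    case True
    then have "z = 2 * a" using z by simp
    then have "z \<in> sqrt_tower ps"
      using sqrt_tower_mult[OF sqrt_tower_of_nat[of 2] ab(1)] by simp
    then show ?thesis using Cons.IH sqrt_tower_Cons_mono by blast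
  next
    case False
    define n where "n = inverse (a * a - b * b * p)"
    have n: "n \<in> sqrt_tower ps"
      unfolding n_def using ab by (intro Cons.IH sqrt_tower_diff sqrt_tower_mult sqrt_tower_of_nat)
    \<comment> \<open>Rationalise the denominator with the conjugate \<open>a - b * sqrt p\<close>.\<close>
    have "a * a - b * b * p = z * (a - b * sqrt p)"
      by (simp add: z algebra_simps)
    then have "inverse z = (a - b * sqrt p) * n"
      using False by (simp add: n_def)
    then have "inverse z = a * n + (- (b * n)) * sqrt p"
      by (simp add: algebra_simps)
    moreover have "a * n \<in> sqrt_tower ps" "- (b * n) \<in> sqrt_tower ps"
      using ab n by (auto intro: sqrt_tower_mult sqrt_tower_uminus)
    ultimately show ?thesis using sqrt_tower_ConsI by metis
  qed
qed simp

text \<open>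
  Kummer theory for square roots, by descent along the tower.  If \<open>\<surd>n = a + b \<surd>p\<close>, squaring shows
  that \<open>\<surd>p\<close> lies one level down unless \<open>a = 0\<close> or \<open>b = 0\<close>.  For \<open>b = 0\<close>, and likewise if \<open>\<surd>p\<close>
  lies one level down, \<open>\<surd>n\<close> itself does; for \<open>a = 0\<close> it is \<open>\<surd>(n p)\<close> that does, which puts \<open>p\<close>
  into the list \<open>qs\<close>.
\<close>

lemma sqrt_in_sqrt_tower:
  assumes "sqrt (real n) \<in> sqrt_tower ps"
  shows "\<exists>qs. subseq qs ps \<and> sqrt (real (n * prod_list qs)) \<in> \<rat>"
  using assms
proof (induction ps arbitrary: n)
  case Nil
  then show ?case by auto
next
  case (Cons p ps)
  then obtain a b where n: "sqrt n = a + b * sqrt p"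
    and ab: "a \<in> sqrt_tower ps" "b \<in> sqrt_tower ps"
    by auto
  show ?case
  proof (cases "sqrt n \<in> sqrt_tower ps")
    case True
    then show ?thesis using Cons.IH by (meson list_emb_Cons)
  next
    case False
    have p: "sqrt p \<notin> sqrt_tower ps"
      using False ab n by (auto intro: sqrt_tower_add sqrt_tower_mult)
    have "b \<noteq> 0" using False n ab by auto
    have "real n = (a + b * sqrt p)\<^sup>2" by (simp flip: n)
    then have "real n - a * a - b * b * p = 2 * a * b * sqrt p"
      by (simp add: power2_eq_square algebra_simps)
    then have "sqrt p = (real n - a * a - b * b * p) * inverse (2 * a * b)" if "a \<noteq> 0"
      using that \<open>b \<noteq> 0\<close> by (simp add: field_simps)
    moreover have "(real n - a * a - b * b * p) * inverse (2 * a * b) \<in> sqrt_tower ps"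
      using ab sqrt_tower_of_nat[of 2 ps]
      by (intro sqrt_tower_mult sqrt_tower_inverse sqrt_tower_diff sqrt_tower_of_nat) auto
    ultimately have "a = 0" using p by metis
    then have "sqrt (real (n * p)) = b * real p"
      using n by (simp add: real_sqrt_mult)
    then have "sqrt (real (n * p)) \<in> sqrt_tower ps"
      using ab by (auto intro: sqrt_tower_mult sqrt_tower_of_nat)
    then obtain qs where "subseq qs ps" "sqrt (real (n * p * prod_list qs)) \<in> \<rat>"
      using Cons.IH by blast
    then show ?thesis by (intro exI[of _ "p # qs"]) (auto simp: mult.assoc)
  qed
qed

lemma even_multiplicity_if_sqrt_rational:
  fixes m p :: nat
  assumes "sqrt (real m) \<in> \<rat>" "m > 0" "prime p"
  shows "even (multiplicity p m)"
proof -
  obtain a b :: nat where "b \<noteq> 0" and ab: "\<bar>sqrt (real m)\<bar> = real a / real b"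
    using Rats_abs_nat_div_natE[OF assms(1)] by metis
  then have "sqrt (real m) * real b = real a" by simp
  then have "real m * (real b)\<^sup>2 = (real a)\<^sup>2" by (metis of_nat_0_le_iff power_mult_distrib real_sqrt_pow2)
  then have eq: "m * b\<^sup>2 = a\<^sup>2" by (metis of_nat_eq_iff of_nat_mult of_nat_power)
  then have "a \<noteq> 0" using assms(2) \<open>b \<noteq> 0\<close> by (metis mult_eq_0_iff neq0_conv zero_power2 power_not_zero)
  have "multiplicity p m + 2 * multiplicity p b = multiplicity p (m * b\<^sup>2)"
    using assms \<open>b \<noteq> 0\<close> by (simp add: prime_elem_multiplicity_mult_distrib prime_elem_multiplicity_power_distrib)
  also have "\<dots> = 2 * multiplicity p a"
    using assms \<open>a \<noteq> 0\<close> by (simp add: eq prime_elem_multiplicity_power_distrib)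
  finally show ?thesis by presburger
qed

lemma sqrt_new_prime_notin_sqrt_tower:
  assumes "prime p" "p \<notin> set ps" "\<forall>q\<in>set ps. prime q"
  shows "sqrt (real p) \<notin> sqrt_tower ps"
proof
  assume "sqrt (real p) \<in> sqrt_tower ps"
  then obtain qs where qs: "subseq qs ps" "sqrt (real (p * prod_list qs)) \<in> \<rat>"
    using sqrt_in_sqrt_tower by blast
  then have "set qs \<subseteq> set ps" by (auto dest: list_emb_set simp: subset_iff)
  then have primes: "\<forall>q\<in>set qs. prime q \<and> q \<noteq> p" using assms by auto
  then have "\<not> p dvd prod_list qs"
  proof (induction qs)
    case (Cons q qs)
    then have "\<not> p dvd q" using assms(1) primes_dvd_imp_eq by auto
    then show ?case using Cons assms(1) by (simp add: prime_dvd_mult_iff)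
  qed (use assms in auto)
  moreover have "prod_list qs > 0"
    using primes by (induction qs) (auto simp: prime_gt_0_nat)
  ultimately have "multiplicity p (p * prod_list qs) = 1"
    using assms(1) by (simp add: prime_elem_multiplicity_mult_distrib not_dvd_imp_multiplicity_0)
  moreover have "even (multiplicity p (p * prod_list qs))"
    using qs assms(1) \<open>prod_list qs > 0\<close>
    by (intro even_multiplicity_if_sqrt_rational) (auto simp: prime_gt_0_nat)
  ultimately show False by simp
qed

lemma squarefree_div_prime:
  fixes p d :: nat
  assumes "squarefree d" "prime p" "p dvd d"
  shows "squarefree (d div p)" "prime_factors (d div p) = prime_factors d - {p}"
proof -
  obtain e where d: "d = p * e" using assms(3) by (auto simp: dvd_def)
  have "d \<noteq> 0" using assms(1) by (metis not_squarefree_0)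
  then have "e \<noteq> 0" "p \<noteq> 0" using d by auto
  have "squarefree e" using assms(1) by (rule squarefree_mono[rotated]) (simp add: d)
  then show "squarefree (d div p)" using d \<open>p \<noteq> 0\<close> by simp
  have "\<not> p dvd e"
  proof
    assume "p dvd e"
    then have "p\<^sup>2 dvd d" using d by (simp add: power2_eq_square)
    then have "p dvd 1" using assms(1) unfolding squarefree_def by blast
    then show False using assms(2) by auto
  qed
  then show "prime_factors (d div p) = prime_factors d - {p}"
    using d \<open>e \<noteq> 0\<close> \<open>p \<noteq> 0\<close> assms(2)
    by (auto simp: prime_factors_product prime_prime_factors in_prime_factors_iff)
qed

lemma sqrt_squarefree_in_sqrt_tower:
  assumes "squarefree d" "prime_factors d \<subseteq> set ps"
  shows "sqrt (real d) \<in> sqrt_tower ps"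
  using assms
proof (induction ps arbitrary: d)
  case Nil
  then have "d = 1" by (auto simp: prime_factorization_empty_iff)
  then show ?case by simp
next
  case (Cons p ps)
  show ?case
  proof (cases "p \<in> prime_factors d")
    case True
    then have p: "prime p" "p dvd d" by auto
    have "sqrt (real (d div p)) \<in> sqrt_tower ps"
      using Cons.prems squarefree_div_prime[OF Cons.prems(1) p] by (intro Cons.IH) auto
    moreover have "sqrt (real d) = 0 + sqrt (real (d div p)) * sqrt (real p)"
      using p by (simp flip: real_sqrt_mult of_nat_mult)
    ultimately show ?thesis
      using sqrt_tower_ConsI[OF sqrt_tower_of_nat[of 0]] by fastforce
  next
    case False
    then show ?thesis using Cons by (intro sqrt_tower_Cons_mono) auto
  qed
qed

lemma sqrt_tower_sum:
  "(\<And>j. j \<in> J \<Longrightarrow> f j \<in> sqrt_tower ps) \<Longrightarrow> sum f J \<in> sqrt_tower ps"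
  using sqrt_tower_of_nat[of 0 ps]
  by (induction J rule: infinite_finite_induct) (auto intro: sqrt_tower_add)

text \<open>
  Induction on the primes involved.  Collecting the terms whose radicand is divisible by the prime
  \<open>p\<close> turns the relation into \<open>A + B \<surd>p = 0\<close> with \<open>A\<close> and \<open>B\<close> in the field generated by the
  square roots of the remaining primes; \<open>\<surd>p\<close> is not in that field, so \<open>A = B = 0\<close> are two
  shorter relations.  An index set, in place of the set of radicands, avoids reindexing when the
  radicands are divided by \<open>p\<close>.
\<close>

lemma sqrt_squarefree_independent:
  fixes d :: "'a \<Rightarrow> nat" and c :: "'a \<Rightarrow> real"
  assumes "distinct ps" "\<forall>p\<in>set ps. prime p" "finite J" "inj_on d J"
    and "\<forall>j\<in>J. squarefree (d j) \<and> prime_factors (d j) \<subseteq> set ps \<and> c j \<in> \<rat>"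
    and "(\<Sum>j\<in>J. c j * sqrt (real (d j))) = 0"
  shows "\<forall>j\<in>J. c j = 0"
  using assms
proof (induction ps arbitrary: J d)
  case Nil
  then have d: "\<forall>j\<in>J. d j = 1" by (auto simp: prime_factorization_empty_iff)
  show ?case
  proof
    fix j assume j: "j \<in> J"
    then have "J = {j}" using d Nil.prems(4) by (auto simp: inj_on_def)
    then show "c j = 0" using Nil.prems(6) d by simp
  qed
next
  case (Cons p ps)
  define J1 where "J1 = {j\<in>J. p dvd d j}"
  define J0 where "J0 = {j\<in>J. \<not> p dvd d j}"
  define e where "e j = d j div p" for j
  have p: "prime p" using Cons.prems by simp
  have fin: "finite J0" "finite J1" using Cons.prems by (auto simp: J0_def J1_def)
  define A where "A = (\<Sum>j\<in>J0. c j * sqrt (real (d j)))"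
  define B where "B = (\<Sum>j\<in>J1. c j * sqrt (real (e j)))"
  have J0: "\<forall>j\<in>J0. squarefree (d j) \<and> prime_factors (d j) \<subseteq> set ps \<and> c j \<in> \<rat>"
    using Cons.prems by (auto simp: J0_def subset_iff in_prime_factors_iff)
  have J1: "\<forall>j\<in>J1. squarefree (e j) \<and> prime_factors (e j) \<subseteq> set ps \<and> c j \<in> \<rat>"
  proof
    fix j assume j: "j \<in> J1"
    then have dj: "squarefree (d j)" "prime_factors (d j) \<subseteq> set (p # ps)" "c j \<in> \<rat>" "p dvd d j"
      using Cons.prems(5) by (auto simp: J1_def)
    show "squarefree (e j) \<and> prime_factors (e j) \<subseteq> set ps \<and> c j \<in> \<rat>"
      using squarefree_div_prime[OF dj(1) p dj(4)] dj unfolding e_def by auto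
  qed
  have de: "d j = e j * p" if "j \<in> J1" for j
    using that by (simp add: J1_def e_def)
  have "A \<in> sqrt_tower ps" "B \<in> sqrt_tower ps"
    unfolding A_def B_def using J0 J1
    by (blast intro: sqrt_tower_sum sqrt_tower_mult sqrt_squarefree_in_sqrt_tower sqrt_tower_Rats)+
  have "(\<Sum>j\<in>J. c j * sqrt (real (d j))) = A + (\<Sum>j\<in>J1. c j * sqrt (real (d j)))"
    unfolding A_def using fin by (subst sum.union_disjoint [symmetric]) (auto simp: J0_def J1_def intro!: sum.cong)
  also have "(\<Sum>j\<in>J1. c j * sqrt (real (d j))) = B * sqrt (real p)"
    unfolding B_def sum_distrib_right using de by (intro sum.cong) (auto simp: real_sqrt_mult)
  finally have AB: "A + B * sqrt (real p) = 0" using Cons.prems by simp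
  have "B = 0"
  proof (rule ccontr)
    assume "B \<noteq> 0"
    then have "sqrt (real p) = (- A) * inverse B"
      using AB by (simp add: field_simps eq_neg_iff_add_eq_0)
    then have "sqrt (real p) \<in> sqrt_tower ps"
      using \<open>A \<in> _\<close> \<open>B \<in> _\<close> by (simp add: sqrt_tower_mult sqrt_tower_inverse sqrt_tower_uminus)
    then show False using sqrt_new_prime_notin_sqrt_tower[OF p, of ps] Cons.prems by simp
  qed
  then have "A = 0" using AB by simp
  have "\<forall>j\<in>J0. c j = 0"
    using Cons.prems J0 fin \<open>A = 0\<close> by (intro Cons.IH[of J0 d]) (auto simp: A_def J0_def inj_on_def)
  moreover have "inj_on e J1"
    using Cons.prems(4) de unfolding inj_on_def J1_def by (metis (mono_tags, lifting) mem_Collect_eq)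
  then have "\<forall>j\<in>J1. c j = 0"
    using Cons.prems J1 fin \<open>B = 0\<close> by (intro Cons.IH[of J1 e]) (auto simp: B_def)
  ultimately show ?case by (auto simp: J0_def J1_def)
qed

lemma sqrt_distinct_squarefree_parts_independent:
  fixes a :: "'a \<Rightarrow> nat" and c :: "'a \<Rightarrow> real"
  assumes "finite J" "\<forall>j\<in>J. a j > 0" "inj_on (\<lambda>j. squarefree_part (a j)) J" "\<forall>j\<in>J. c j \<in> \<rat>"
    and "(\<Sum>j\<in>J. c j * sqrt (real (a j))) = 0"
  shows "\<forall>j\<in>J. c j = 0"
proof -
  define d where "d j = squarefree_part (a j)" for j
  define ps where "ps = sorted_list_of_set (\<Union>j\<in>J. prime_factors (d j))"
  have ps: "distinct ps" "set ps = (\<Union>j\<in>J. prime_factors (d j))"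
    using assms(1) by (auto simp: ps_def)
  have root: "sqrt (real (a j)) = real (square_part (a j)) * sqrt (real (d j))" for j
  proof -
    have "real (a j) = real (d j) * (real (square_part (a j)))\<^sup>2"
      unfolding d_def by (metis of_nat_mult of_nat_power squarefree_decompose)
    then show ?thesis by (simp add: real_sqrt_mult)
  qed
  have "\<forall>j\<in>J. c j * real (square_part (a j)) = 0"
  proof (rule sqrt_squarefree_independent[where d = d and ps = ps])
    show "(\<Sum>j\<in>J. c j * real (square_part (a j)) * sqrt (real (d j))) = 0"
      using assms(5) by (simp add: root mult.assoc)
  qed (use assms ps in \<open>auto simp: d_def [abs_def]\<close>)
  then show ?thesis using assms(2) by fastforce
qed

section \<open>Elementary inequalities\<close>

text \<open>
  The cubic minus \<open>ln\<close> has derivative \<open>(t - 1/2) (t - 2) (t - 4) / (4 t)\<close>, so its minimum over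
  \<open>t > 0\<close> is attained at \<open>1/2\<close> or \<open>4\<close>; the constant \<open>- 1.84\<close> makes both values nonnegative.  Two
  points of near contact, on either side of the mean value \<open>t = 1\<close>, are what pushes the mean of the
  cubic below \<open>- 1/4\<close> for spread-out \<open>t\<close>; contact at a single point is not enough.
\<close>

lemma ln_le_cubic:
  fixes t :: real
  assumes "t > 0"
  shows "ln t \<le> - 1.84 + 11 / 4 * t - 13 / 16 * t\<^sup>2 + 1 / 12 * t ^ 3"
proof -
  define h where "h u = - 1.84 + 11 / 4 * u - 13 / 16 * u\<^sup>2 + 1 / 12 * u ^ 3 - ln u" for u :: real
  define h' where "h' u = (u - 1 / 2) * (u - 2) * (u - 4) / (4 * u)" for u :: real
  have deriv: "(h has_real_derivative h' u) (at u)" if "u > 0" for u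
    unfolding h_def h'_def using that
    by (auto intro!: derivative_eq_intros simp: field_simps power2_eq_square power3_eq_cube)
  have half: "h (1 / 2) \<ge> 0"
    using ln2_ge_two_thirds by (simp add: h_def ln_div power2_eq_square power3_eq_cube)
  have "ln (4::real) = 2 * ln 2"
    using ln_realpow[of 2 2] by simp
  then have four: "h 4 \<ge> 0"
    using ln2_le_25_over_36 by (simp add: h_def)
  consider "t \<le> 1 / 2" | "1 / 2 \<le> t" "t \<le> 2" | "2 \<le> t" "t \<le> 4" | "4 \<le> t" by linarith
  then have "h t \<ge> 0"
  proof cases
    case 1
    have "h (1 / 2) \<le> h t"
    proof (rule DERIV_nonpos_imp_nonincreasing[OF 1])
      fix u assume u: "t \<le> u" "u \<le> 1 / 2"
      then have "(u - 1 / 2) * ((u - 2) * (u - 4)) \<le> 0"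
        by (intro mult_nonpos_nonneg mult_nonpos_nonpos) auto
      then have "h' u \<le> 0" using u assms by (simp add: h'_def divide_nonpos_pos mult.assoc)
      then show "\<exists>y. DERIV h u :> y \<and> y \<le> 0" using deriv[of u] u assms by (intro exI[of _ "h' u"]) simp
    qed
    then show ?thesis using half by simp
  next
    case 2
    have "h (1 / 2) \<le> h t"
    proof (rule DERIV_nonneg_imp_nondecreasing[OF 2(1)])
      fix u assume u: "1 / 2 \<le> u" "u \<le> t"
      then have "(u - 1 / 2) * ((u - 2) * (u - 4)) \<ge> 0"
        using 2 by (intro mult_nonneg_nonneg mult_nonpos_nonpos) auto
      then have "h' u \<ge> 0" using u by (simp add: h'_def mult.assoc)
      then show "\<exists>y. DERIV h u :> y \<and> y \<ge> 0" using deriv[of u] u by (intro exI[of _ "h' u"]) simp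
    qed
    then show ?thesis using half by simp
  next
    case 3
    have "h 4 \<le> h t"
    proof (rule DERIV_nonpos_imp_nonincreasing[OF 3(2)])
      fix u assume u: "t \<le> u" "u \<le> 4"
      then have "(u - 1 / 2) * ((u - 2) * (u - 4)) \<le> 0"
        using 3 by (intro mult_nonneg_nonpos) auto
      then have "h' u \<le> 0" using u 3 by (simp add: h'_def divide_nonpos_pos mult.assoc)
      then show "\<exists>y. DERIV h u :> y \<and> y \<le> 0" using deriv[of u] u 3 by (intro exI[of _ "h' u"]) simp
    qed
    then show ?thesis using four by simp
  next
    case 4
    have "h 4 \<le> h t"
    proof (rule DERIV_nonneg_imp_nondecreasing[OF 4])
      fix u assume u: "4 \<le> u" "u \<le> t"
      then have "h' u \<ge> 0" by (simp add: h'_def)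
      then show "\<exists>y. DERIV h u :> y \<and> y \<ge> 0" using deriv[of u] u by (intro exI[of _ "h' u"]) simp
    qed
    then show ?thesis using four by simp
  qed
  then show ?thesis by (simp add: h_def)
qed

text \<open>
  Truncating after an odd power gives a lower bound for every real argument, as the Lagrange
  remainder carries an even power.
\<close>

lemma exp_ge_taylor5:
  fixes x :: real
  shows "1 + x + x\<^sup>2 / 2 + x ^ 3 / 6 + x ^ 4 / 24 + x ^ 5 / 120 \<le> exp x"
proof -
  obtain t where "exp x = (\<Sum>m<6. x ^ m / fact m) + exp t / fact 6 * x ^ 6"
    using Maclaurin_exp_le[of x 6] by blast
  moreover have "exp t / fact 6 * x ^ 6 \<ge> 0" by (simp add: zero_le_even_power)
  moreover have "(\<Sum>m<6. x ^ m / fact m) = 1 + x + x\<^sup>2 / 2 + x ^ 3 / 6 + x ^ 4 / 24 + x ^ 5 / 120"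
    by (simp add: eval_nat_numeral)
  ultimately show ?thesis by linarith
qed

text \<open>
  The numerical heart of the dominant regime, with \<open>h = 1 / K\<close>.  The left side is a convex
  quadratic in \<open>q\<close>, largest at the left end of the given interval; the offset \<open>h / 400\<close> there
  absorbs the size of the full sum.  At \<open>q = h\<close> both sides agree up to terms of order \<open>h\<^sup>2\<close>, where
  \<open>1 - 4 h + 6 h\<^sup>2\<close> is compared with \<open>exp (- 4 h) = 1 - 4 h + 8 h\<^sup>2 - \<dots>\<close>.  So the coefficient of
  \<open>h\<^sup>2\<close> in the exponent has to stay below 2; the value 1.7 is small enough for the inequality to hold
  up to \<open>h = 1 / 8\<close>, where there is little room, and large enough for its application.
\<close>

lemma dominant_quadratic_bound:
  fixes h q :: real
  assumes h: "0 < h" "h \<le> 1 / 8" and q: "(1 - h / 400) * h \<le> q" "q \<le> 1 / 2"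
  shows "1 - 4 * q + (6 - 2 * h) * q\<^sup>2 \<le> exp (- 4 * h - 1.7 * h\<^sup>2)"
proof -
  define q0 where "q0 = (1 - h / 400) * h"
  have q0: "0 \<le> q0" "q0 \<le> h" using h by (auto simp: q0_def field_simps)
  have "(q - q0) * (- 4 + (6 - 2 * h) * (q + q0)) \<le> 0"
  proof (rule mult_nonneg_nonpos)
    have "(6 - 2 * h) * (q + q0) \<le> 6 * (5 / 8)"
      using h q q0 by (intro mult_mono) (auto simp: q0_def[symmetric])
    then show "- 4 + (6 - 2 * h) * (q + q0) \<le> 0" by simp
  qed (use q q0_def in auto)
  then have "1 - 4 * q + (6 - 2 * h) * q\<^sup>2 \<le> 1 - 4 * q0 + (6 - 2 * h) * q0\<^sup>2"
    by (simp add: power2_eq_square algebra_simps)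
  also have "\<dots> \<le> 1 - 4 * q0 + (6 - 2 * h) * h\<^sup>2"
    using q0 h by (intro add_left_mono mult_left_mono power_mono) auto
  also have "\<dots> = 1 - 4 * h + 6.01 * h\<^sup>2 - 2 * h ^ 3"
    by (simp add: q0_def power2_eq_square power3_eq_cube algebra_simps)
  \<comment> \<open>The difference of the two sides is displayed below as a sum of nonnegative terms.\<close>
  also have "\<dots> \<le> (1 + (-4*h) + (-4*h)\<^sup>2 / 2 + (-4*h) ^ 3 / 6 + (-4*h) ^ 4 / 24 + (-4*h) ^ 5 / 120) * (1 - 1.7 * h\<^sup>2)"
  proof -
    have "h * h\<^sup>2 \<le> h * (1/8)\<^sup>2" using h by (intro mult_left_mono power_mono) auto
    moreover have "h\<^sup>2 \<le> (1/8)\<^sup>2" using h by (intro power_mono) auto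
    ultimately have "0 \<le> 0.29 - 28/15 * h - 44/15 * h\<^sup>2"
      using h by (simp add: power2_eq_square)
    then have "0 \<le> h\<^sup>2 * (0.29 - 28/15 * h - 44/15 * h\<^sup>2) + h ^ 5 * (9.6 - 272/15 * h) + 1088/75 * h ^ 7"
      using h by (intro add_nonneg_nonneg mult_nonneg_nonneg) auto
    also have "\<dots> = (1 + (-4*h) + (-4*h)\<^sup>2 / 2 + (-4*h) ^ 3 / 6 + (-4*h) ^ 4 / 24 + (-4*h) ^ 5 / 120) * (1 - 1.7 * h\<^sup>2)
        - (1 - 4 * h + 6.01 * h\<^sup>2 - 2 * h ^ 3)"
      by (simp add: eval_nat_numeral field_simps)
    finally show ?thesis by simp
  qed
  also have "\<dots> \<le> exp (- 4 * h) * exp (- 1.7 * h\<^sup>2)"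
  proof (rule mult_mono)
    show "1 - 1.7 * h\<^sup>2 \<le> exp (- 1.7 * h\<^sup>2)" using exp_ge_add_one_self[of "- 1.7 * h\<^sup>2"] by simp
    have "h\<^sup>2 \<le> (1/8)\<^sup>2" using h by (intro power_mono) auto
    then show "0 \<le> 1 - 1.7 * h\<^sup>2" by (simp add: power2_eq_square)
  qed (use exp_ge_taylor5[of "- 4 * h"] in auto)
  finally show ?thesis by (simp add: mult_exp_exp)
qed

text \<open>
  Both sides agree for \<open>K = 8\<close>.  With \<open>N = 2 ^ (K - 1) - 1\<close> this says \<open>63 K\<^sup>2 \<le> 32 (N - 1)\<close>.
\<close>

lemma power_dominates_square: "(8::nat) \<le> K \<Longrightarrow> 126 * K\<^sup>2 + 128 \<le> 64 * 2 ^ (K - 1)"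
proof (induction K rule: nat_induct_at_least)
  case (Suc n)
  have "8 * n \<le> n * n" using Suc.hyps by simp
  moreover have "(2::nat) ^ n = 2 * 2 ^ (n - 1)" using Suc.hyps by (cases n) auto
  moreover have "126 * (Suc n)\<^sup>2 + 128 = 126 * (n * n) + 252 * n + 254"
    by (simp add: power2_eq_square)
  ultimately show ?case using Suc.IH unfolding power2_eq_square diff_Suc_1 by linarith
qed simp

section \<open>The mean logarithm of the signed sums\<close>

text \<open>
  Put \<open>X = x k\<close>.  The pair of signed sums that differ only in the sign of \<open>X\<close> contributes
  \<open>ln ((T\<^sup>2 - X\<^sup>2)\<^sup>2)\<close>.  Two pairs contain an excluded sum; from each of them the partner
  \<open>\<plusminus> (S - 2 X)\<close> remains, and its square is bounded by \<open>4.01\<close>.  The other \<open>N - 1\<close> pairs are estimated by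
  \<open>ln v \<le> ln c - 1 + v / c\<close>, where \<open>c\<close> bounds the mean of \<open>v = (T\<^sup>2 - X\<^sup>2)\<^sup>2\<close> over all pairs.
  The loss from the two partners, about \<open>4 ln 2\<close>, is paid for by the term \<open>1.7 h\<^sup>2\<close> in \<open>- ln c\<close>,
  because \<open>h\<^sup>2 (N - 1)\<close> is at least \<open>63 / 32\<close>, with equality for \<open>K = 8\<close>.
\<close>

lemma dominant_log_sum:
  fixes x :: "'a \<Rightarrow> real"
  assumes A: "finite A" "card A = K" "K \<ge> 8" and k: "k \<in> A"
    and unit: "(\<Sum>i\<in>A. (x i)\<^sup>2) = 1" and dom: "(x k)\<^sup>2 \<ge> 1 / 2"
    and small: "\<bar>sum x A\<bar> \<le> \<bar>x k\<bar> / (800 * real K)"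
    and nz: "\<And>I. I \<subseteq> A \<Longrightarrow> signed_sum x A I \<noteq> 0"
    and N: "N = 2 ^ (K - 1) - 1"
  shows "(\<Sum>I\<in>Pow A - {A, {}}. ln ((signed_sum x A I)\<^sup>2)) \<le> 2 - 2 / N - 4 * N / real K"
proof -
  define B where "B = A - {k}"
  define h where "h = 1 / real K"
  define q where "q = (\<Sum>i\<in>B. (x i)\<^sup>2)"
  define X where "X = x k"
  define S where "S = sum x A"
  have B: "finite B" "k \<notin> B" "insert k B = A" "card B = K - 1"
    using A k by (auto simp: B_def)
  have h: "0 < h" "h \<le> 1 / 8" using A by (auto simp: h_def field_simps)
  have "card B > 0" using B A by simp
  then have "B \<noteq> {}" by auto
  have "A \<noteq> {}" using k by auto
  have sumA: "sum f A = f k + sum f B" for f :: "'a \<Rightarrow> real"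
    using B by (metis sum.insert)
  have X: "X\<^sup>2 = 1 - q" using unit sumA[of "\<lambda>i. (x i)\<^sup>2"] by (simp add: q_def X_def)
  have q1: "0 \<le> q" "q \<le> 1 / 2"
    using dom X by (auto simp: q_def sum_nonneg X_def)
  have small': "\<bar>S\<bar> \<le> \<bar>X\<bar> * (h / 800)" using small by (simp add: S_def X_def h_def)
  have hK: "real (K - 1) * h = 1 - h" using A by (simp add: h_def of_nat_diff field_simps)
  have T: "sum x B = S - X" using sumA[of x] by (simp add: S_def X_def)
  \<comment> \<open>Cauchy-Schwarz: the \<open>K - 1\<close> other terms have to cancel \<open>X\<close> almost entirely.\<close>
  have q2: "(1 - h / 400) * h \<le> q"
  proof -
    have "\<bar>X\<bar> * (1 - h / 800) \<le> \<bar>S - X\<bar>" using small' by (simp add: algebra_simps)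
    then have "(\<bar>X\<bar> * (1 - h / 800))\<^sup>2 \<le> \<bar>S - X\<bar>\<^sup>2"
      using h by (intro power_mono) auto
    also have "\<dots> = (sum x B)\<^sup>2" by (simp add: T)
    also have "\<dots> \<le> q * real (K - 1)"
      using sum_squared_le_sum_of_squares[of x B] B by (simp add: q_def)
    finally have "(1 - q) * (1 - h / 800)\<^sup>2 \<le> q * real (K - 1)"
      by (simp add: power_mult_distrib X)
    moreover have "1 - h / 400 \<le> (1 - h / 800)\<^sup>2"
      by (simp add: power2_eq_square algebra_simps)
    then have "(1 - q) * (1 - h / 400) \<le> (1 - q) * (1 - h / 800)\<^sup>2"
      using q1 by (intro mult_left_mono) auto
    ultimately have "(1 - q) * (1 - h / 400) * h \<le> q * real (K - 1) * h"
      using h by (intro mult_right_mono) auto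
    also have "\<dots> = q * (1 - h)" by (simp only: hK mult.assoc)
    also have "\<dots> = q - q * h" by (simp add: algebra_simps)
    finally have "(1 - q) * (1 - h / 400) * h \<le> q - q * h" .
    moreover have "(1 - q) * (1 - h / 400) * h = (1 - h / 400) * h + q * h\<^sup>2 / 400 - q * h"
      by (simp add: power2_eq_square field_simps)
    ultimately have "(1 - h / 400) * h + q * h\<^sup>2 / 400 \<le> q" by linarith
    moreover have "0 \<le> q * h\<^sup>2 / 400" using q1 by simp
    ultimately show ?thesis by linarith
  qed
  define c where "c = exp (- 4 * h - 1.7 * h\<^sup>2)"
  define g where "g = 1 - 4 * q + (6 - 2 * h) * q\<^sup>2"
  have gc: "g \<le> c" unfolding g_def c_def by (rule dominant_quadratic_bound[OF h q2 q1(2)])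
  have N1: "2 ^ (K - 1) = N + 1" using N by simp
  have "(126::real) * (real K)\<^sup>2 + 128 \<le> 64 * 2 ^ (K - 1)"
    using power_dominates_square[OF A(3)] 
    by (metis (mono_tags, lifting) of_nat_le_iff of_nat_add of_nat_mult of_nat_numeral of_nat_power)
  then have NK: "126 * (real K)\<^sup>2 \<le> 64 * (N - 1)" using N1 by simp
  moreover have "8\<^sup>2 \<le> (real K)\<^sup>2" using A(3) by (intro power_mono) auto
  ultimately have N127: "N \<ge> 127" by simp
  have Nh: "1.96875 \<le> h\<^sup>2 * (N - 1)"
    using NK A(3) by (simp add: h_def power_divide field_simps)
  define u where "u J = (signed_sum x B J)\<^sup>2 - X\<^sup>2" for J
  have split: "(X + t) * (- X + t) = t\<^sup>2 - X\<^sup>2" for t :: real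
    by (simp add: power2_eq_square algebra_simps)
  have u_nz: "u J \<noteq> 0" if "J \<subseteq> B" for J
  proof -
    have "X + signed_sum x B J \<noteq> 0"
      using nz[of "insert k J"] that B signed_sum_insert_in[of B k x J] by (auto simp: X_def)
    moreover have "- X + signed_sum x B J \<noteq> 0"
      using nz[of J] that B signed_sum_insert_out[of B k J x] by (auto simp: X_def)
    ultimately show ?thesis using split[of "signed_sum x B J"] by (auto simp: u_def)
  qed
  \<comment> \<open>This fourth power sum supplies the correction \<open>- 2 * h * q\<^sup>2\<close> in \<open>g\<close>; for \<open>K = 8\<close> and \<open>q = h\<close> the quadratic without it exceeds \<open>c\<close>.\<close>
  have s4: "q\<^sup>2 * h \<le> (\<Sum>i\<in>B. (x i) ^ 4)"
  proof -
    have "q\<^sup>2 \<le> (\<Sum>i\<in>B. ((x i)\<^sup>2)\<^sup>2) * real (K - 1)"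
      using sum_squared_le_sum_of_squares[of "\<lambda>i. (x i)\<^sup>2" B] B by (simp add: q_def)
    then have "q\<^sup>2 * h \<le> (\<Sum>i\<in>B. (x i) ^ 4) * (real (K - 1) * h)"
      using h mult_right_mono by fastforce
    also have "\<dots> \<le> (\<Sum>i\<in>B. (x i) ^ 4) * 1"
    proof (rule mult_left_mono)
      show "real (K - 1) * h \<le> 1" unfolding hK using h by simp
    qed (simp add: sum_nonneg zero_le_even_power)
    finally show ?thesis by simp
  qed
  have usq: "(\<Sum>J\<in>Pow B. (u J)\<^sup>2) \<le> (N + 1) * g"
  proof -
    have "(u J)\<^sup>2 = (signed_sum x B J) ^ 4 - 2 * X\<^sup>2 * (signed_sum x B J)\<^sup>2 + (X\<^sup>2)\<^sup>2" for J
      by (simp add: u_def power2_eq_square power4_eq_xxxx algebra_simps)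
    then have "(\<Sum>J\<in>Pow B. (u J)\<^sup>2) =
        (\<Sum>J\<in>Pow B. (signed_sum x B J) ^ 4) - 2 * X\<^sup>2 * (\<Sum>J\<in>Pow B. (signed_sum x B J)\<^sup>2)
        + 2 ^ card B * (X\<^sup>2)\<^sup>2"
      using B by (simp add: sum.distrib sum_subtractf sum_distrib_left card_Pow)
    also have "\<dots> = (N + 1) * (3 * q\<^sup>2 - 2 * (\<Sum>i\<in>B. (x i) ^ 4) - 2 * (1 - q) * q + (1 - q)\<^sup>2)"
      unfolding signed_sum_fourth_moment[OF B(1)] signed_sum_second_moment[OF B(1)] X B(4) N1
      by (simp add: algebra_simps flip: q_def)
    also have "\<dots> \<le> (N + 1) * g"
      using N127 s4 by (intro mult_left_mono) (auto simp: g_def power2_eq_square algebra_simps)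
    finally show ?thesis .
  qed
  define P where "P = Pow B - {B, {}}"
  have cardP: "real (card P) = N - 1"
  proof -
    have "card P = 2 ^ (K - 1) - 2"
      unfolding P_def using B \<open>B \<noteq> {}\<close> by (subst card_Diff_subset) (auto simp: card_Pow)
    moreover have "(2::nat) ^ 1 \<le> 2 ^ (K - 1)" using A(3) by (intro power_increasing) auto
    ultimately show ?thesis using N by (simp add: of_nat_diff)
  qed
  have "(\<Sum>J\<in>P. ln ((u J)\<^sup>2)) \<le> (\<Sum>J\<in>P. ln c - 1 + (u J)\<^sup>2 / c)"
  proof (rule sum_mono)
    fix J assume "J \<in> P"
    then have "(u J)\<^sup>2 > 0" using u_nz by (auto simp: P_def)
    then have "ln ((u J)\<^sup>2 / c) \<le> (u J)\<^sup>2 / c - 1" by (intro ln_le_minus_one) (auto simp: c_def)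
    then show "ln ((u J)\<^sup>2) \<le> ln c - 1 + (u J)\<^sup>2 / c"
      using \<open>(u J)\<^sup>2 > 0\<close> by (simp add: ln_div c_def)
  qed
  also have "\<dots> = (N - 1) * (ln c - 1) + (\<Sum>J\<in>P. (u J)\<^sup>2) / c"
    by (simp add: sum.distrib sum_divide_distrib cardP)
  also have "(\<Sum>J\<in>P. (u J)\<^sup>2) / c \<le> N + 1"
  proof -
    have "(\<Sum>J\<in>P. (u J)\<^sup>2) \<le> (\<Sum>J\<in>Pow B. (u J)\<^sup>2)"
      unfolding P_def using B by (intro sum_mono2) auto
    also have "\<dots> \<le> (N + 1) * c"
      using usq mult_left_mono[OF gc, of "N + 1"] N127 by linarith
    finally show ?thesis by (simp add: c_def field_simps)
  qed
  finally have main: "(\<Sum>J\<in>P. ln ((u J)\<^sup>2)) \<le> (N - 1) * ln c + 2" by (simp add: algebra_simps)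
  have S_nz: "S \<noteq> 0" using nz[of A] by (simp add: S_def signed_sum_full)
  have S2_nz: "S - 2 * X \<noteq> 0"
    using u_nz[of B] by (auto simp: u_def signed_sum_full T power2_eq_square algebra_simps)
  have uS: "ln ((u J)\<^sup>2) = ln (S\<^sup>2) + ln ((S - 2 * X)\<^sup>2)" if "J \<in> {B, {}}" for J
  proof -
    have "(u J)\<^sup>2 = S\<^sup>2 * (S - 2 * X)\<^sup>2"
      using that by (auto simp: u_def signed_sum_full signed_sum_none T power2_eq_square algebra_simps)
    then show ?thesis using S_nz S2_nz by (simp add: ln_mult)
  qed
  have "(\<Sum>I\<in>Pow A. ln ((signed_sum x A I)\<^sup>2)) = (\<Sum>J\<in>Pow B. ln ((u J)\<^sup>2))"
    unfolding B(3)[symmetric] sum_signed_insert[OF B(1,2), of "\<lambda>s. ln (s\<^sup>2)"]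
  proof (rule sum.cong)
    fix J assume "J \<in> Pow B"
    then have "u J \<noteq> 0" using u_nz by simp
    moreover have "u J = (X + signed_sum x B J) * (- X + signed_sum x B J)"
      by (simp only: split u_def)
    ultimately show "ln ((x k + signed_sum x B J)\<^sup>2) + ln ((- x k + signed_sum x B J)\<^sup>2) = ln ((u J)\<^sup>2)"
      unfolding X_def by (simp add: power_mult_distrib ln_mult)
  qed simp
  also have "\<dots> = (\<Sum>J\<in>P. ln ((u J)\<^sup>2)) + (\<Sum>J\<in>{B, {}}. ln ((u J)\<^sup>2))"
    unfolding P_def using B by (intro sum.subset_diff) auto
  also have "(\<Sum>J\<in>{B, {}}. ln ((u J)\<^sup>2)) = 2 * ln (S\<^sup>2) + 2 * ln ((S - 2 * X)\<^sup>2)"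
    using uS \<open>B \<noteq> {}\<close> by simp
  finally have all: "(\<Sum>I\<in>Pow A. ln ((signed_sum x A I)\<^sup>2))
      = (\<Sum>J\<in>P. ln ((u J)\<^sup>2)) + (2 * ln (S\<^sup>2) + 2 * ln ((S - 2 * X)\<^sup>2))" .
  have "(\<Sum>I\<in>Pow A. ln ((signed_sum x A I)\<^sup>2))
      = (\<Sum>I\<in>Pow A - {A, {}}. ln ((signed_sum x A I)\<^sup>2)) + (\<Sum>I\<in>{A, {}}. ln ((signed_sum x A I)\<^sup>2))"
    using A by (intro sum.subset_diff) auto
  also have "(\<Sum>I\<in>{A, {}}. ln ((signed_sum x A I)\<^sup>2)) = 2 * ln (S\<^sup>2)"
    using \<open>A \<noteq> {}\<close> by (simp add: signed_sum_full signed_sum_none S_def)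
  finally have "(\<Sum>I\<in>Pow A - {A, {}}. ln ((signed_sum x A I)\<^sup>2))
      = (\<Sum>J\<in>P. ln ((u J)\<^sup>2)) + 2 * ln ((S - 2 * X)\<^sup>2)"
    using all by simp
  also have "\<dots> \<le> (N - 1) * ln c + 2 + 2 * (25 / 18 + 0.0025)"
  proof -
    have "X\<^sup>2 \<le> 1\<^sup>2" using X q1 by simp
    then have "\<bar>X\<bar> \<le> 1" by (metis abs_le_square_iff abs_one)
    then have "\<bar>X\<bar> * (h / 800) \<le> 1 * (1 / 6400)" using h by (intro mult_mono) auto
    then have "\<bar>S - 2 * X\<bar> \<le> 1001 / 500" using small' \<open>\<bar>X\<bar> \<le> 1\<close> by linarith
    then have "\<bar>S - 2 * X\<bar>\<^sup>2 \<le> (1001 / 500)\<^sup>2" by (intro power_mono) auto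
    then have "(S - 2 * X)\<^sup>2 \<le> 2\<^sup>2 * (1 + 0.0025)" by (simp add: power2_eq_square)
    then have "ln ((S - 2 * X)\<^sup>2) \<le> ln (2\<^sup>2 * (1 + 0.0025))"
      using S2_nz by (subst ln_le_cancel_iff) auto
    also have "\<dots> = 2 * ln 2 + ln (1 + 0.0025)"
      using ln_realpow[of "2::real" 2] by (subst ln_mult) auto
    also have "\<dots> \<le> 25 / 18 + 0.0025"
      using ln2_le_25_over_36 ln_add_one_self_le_self[of "0.0025"] by simp
    finally show ?thesis using main by simp
  qed
  also have "\<dots> \<le> 2 - 2 / N - 4 * N / real K"
  proof -
    have "2 / N \<le> 2 / 127" using N127 by (intro divide_left_mono) auto
    moreover have "(N - 1) * ln c = - 4 * (N * h) + 4 * h - 1.7 * (h\<^sup>2 * (N - 1))"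
      by (simp add: c_def field_simps)
    moreover have "4 * N / real K = 4 * (N * h)" by (simp add: h_def)
    ultimately show ?thesis using Nh h by simp
  qed
  finally show ?thesis .
qed

text \<open>
  With \<open>S4\<close> and \<open>S6\<close> the power sums of order 4 and 6, the mean of the cubic is
  \<open>- 0.2775 - (7/8) S4 + (4/3) S6\<close>, and \<open>S6 \<le> S4 / 2\<close> as no term dominates.  So the mean is at most
  \<open>- 0.2775\<close>.  The margin below \<open>- 1/4\<close>, multiplied by \<open>2 ^ K\<close>, outweighs the two excluded terms, at
  which the cubic is at least \<open>- 1.84\<close>.
\<close>

lemma balanced_log_sum:
  fixes x :: "'a \<Rightarrow> real"
  assumes A: "finite A" "card A = K" "K \<ge> 8"
    and unit: "(\<Sum>i\<in>A. (x i)\<^sup>2) = 1" and bal: "\<And>i. i \<in> A \<Longrightarrow> (x i)\<^sup>2 \<le> 1 / 2"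
    and small: "\<bar>sum x A\<bar> \<le> 1"
    and nz: "\<And>I. I \<subseteq> A \<Longrightarrow> signed_sum x A I \<noteq> 0"
    and N: "N = 2 ^ (K - 1) - 1"
  shows "(\<Sum>I\<in>Pow A - {A, {}}. ln ((signed_sum x A I)\<^sup>2)) \<le> 2 - 2 / N - 4 * N / real K"
proof -
  define s where "s I = signed_sum x A I" for I
  define f where "f t = - 1.84 + 11 / 4 * t - 13 / 16 * t\<^sup>2 + 1 / 12 * t ^ 3" for t :: real
  define S4 where "S4 = (\<Sum>i\<in>A. (x i) ^ 4)"
  define S6 where "S6 = (\<Sum>i\<in>A. (x i) ^ 6)"
  have "A \<noteq> {}" using A by auto
  have N1: "2 ^ K = 2 * N + 2" using N A(3) by (cases K) auto
  have "(2::real) ^ 7 \<le> 2 ^ (K - 1)" using A(3) by (intro power_increasing) auto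
  then have N127: "N \<ge> 127" using N by simp
  have "S4 \<ge> 0" unfolding S4_def by (intro sum_nonneg) (simp add: zero_le_even_power)
  have "S6 \<le> (\<Sum>i\<in>A. 1 / 2 * (x i) ^ 4)"
    unfolding S6_def
  proof (rule sum_mono)
    fix i assume "i \<in> A"
    then have "(x i)\<^sup>2 * (x i) ^ 4 \<le> 1 / 2 * (x i) ^ 4"
      using bal by (intro mult_right_mono) (auto simp: zero_le_even_power)
    then show "(x i) ^ 6 \<le> 1 / 2 * (x i) ^ 4" by (simp flip: power_add)
  qed
  then have S6: "S6 \<le> S4 / 2" by (simp add: S4_def sum_divide_distrib)
  have "(\<Sum>I\<in>Pow A. f ((s I)\<^sup>2)) =
      (\<Sum>I\<in>Pow A. - 1.84 + 11 / 4 * (s I)\<^sup>2 - 13 / 16 * (s I) ^ 4 + 1 / 12 * (s I) ^ 6)"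
    by (simp add: f_def flip: power_mult)
  also have "\<dots> = 2 ^ K * (- 1.84) + 11 / 4 * (\<Sum>I\<in>Pow A. (s I)\<^sup>2)
      - 13 / 16 * (\<Sum>I\<in>Pow A. (s I) ^ 4) + 1 / 12 * (\<Sum>I\<in>Pow A. (s I) ^ 6)"
    using A by (simp add: sum.distrib sum_subtractf card_Pow flip: sum_distrib_left sum_divide_distrib)
  also have "\<dots> = 2 ^ K * (- 1.84 + 11 / 4 - 13 / 16 * (3 - 2 * S4) + 1 / 12 * (15 - 30 * S4 + 16 * S6))"
    using A by (simp add: s_def signed_sum_second_moment signed_sum_fourth_moment
        signed_sum_sixth_moment unit flip: S4_def S6_def) (simp add: field_simps)
  also have "\<dots> \<le> 2 ^ K * (- 0.2775)"
    using S6 \<open>S4 \<ge> 0\<close> by (intro mult_left_mono) (auto simp: field_simps)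
  finally have total: "(\<Sum>I\<in>Pow A. f ((s I)\<^sup>2)) \<le> (2 * N + 2) * (- 0.2775)" using N1 by simp
  have "(sum x A)\<^sup>2 \<le> 1" using small by (simp add: abs_square_le_1)
  then have "((sum x A)\<^sup>2)\<^sup>2 \<le> (sum x A)\<^sup>2 * 1"
    unfolding power2_eq_square[of "(sum x A)\<^sup>2"] by (intro mult_left_mono) auto
  moreover have "0 \<le> ((sum x A)\<^sup>2) ^ 3" by simp
  moreover have "0 \<le> (sum x A)\<^sup>2" by simp
  ultimately have "f ((sum x A)\<^sup>2) \<ge> - 1.84"
    unfolding f_def by linarith
  then have ends: "(\<Sum>I\<in>{A, {}}. f ((s I)\<^sup>2)) \<ge> - 3.68"
    using \<open>A \<noteq> {}\<close> by (simp add: s_def signed_sum_full signed_sum_none)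
  have "(\<Sum>I\<in>Pow A - {A, {}}. ln ((s I)\<^sup>2)) \<le> (\<Sum>I\<in>Pow A - {A, {}}. f ((s I)\<^sup>2))"
  proof (rule sum_mono)
    fix I assume "I \<in> Pow A - {A, {}}"
    then have "(s I)\<^sup>2 > 0" using nz by (simp add: s_def)
    then show "ln ((s I)\<^sup>2) \<le> f ((s I)\<^sup>2)" unfolding f_def by (rule ln_le_cubic)
  qed
  also have "\<dots> = (\<Sum>I\<in>Pow A. f ((s I)\<^sup>2)) - (\<Sum>I\<in>{A, {}}. f ((s I)\<^sup>2))"
    using A by (intro sum_diff) auto
  also have "\<dots> \<le> (2 * N + 2) * (- 111 / 400) + 92 / 25" using total ends by simp
  also have "\<dots> \<le> 2 - 2 / N - 4 * N / real K"
  proof -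
    have "(2 * N + 2) * (- 111 / 400) + 92 / 25 \<le> 2 - u - v" if "u \<le> 1" "v \<le> N / 2" for u v
      using that N127 by (simp add: field_simps)
    moreover have "2 / N \<le> 1" using N127 by simp
    moreover have "4 * N / real K \<le> 4 * N / 8" using N127 A(3) by (intro divide_left_mono) auto
    then have "4 * N / real K \<le> N / 2" by simp
    ultimately show ?thesis by blast
  qed
  finally show ?thesis by (simp add: s_def)
qed

lemma log_sum_le_if_unit:
  fixes x :: "'a \<Rightarrow> real"
  assumes A: "finite A" "card A = K" "K \<ge> 8"
    and unit: "(\<Sum>i\<in>A. (x i)\<^sup>2) = 1"
    and small: "\<And>i. i \<in> A \<Longrightarrow> \<bar>sum x A\<bar> \<le> \<bar>x i\<bar> / (800 * real K)"
    and nz: "\<And>I. I \<subseteq> A \<Longrightarrow> signed_sum x A I \<noteq> 0"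
    and N: "N = 2 ^ (K - 1) - 1"
  shows "(\<Sum>I\<in>Pow A - {A, {}}. ln ((signed_sum x A I)\<^sup>2)) \<le> 2 - 2 / N - 4 * N / real K"
proof (cases "\<exists>k\<in>A. (x k)\<^sup>2 \<ge> 1 / 2")
  case True
  then show ?thesis using dominant_log_sum[OF A _ unit _ _ nz N] small by blast
next
  case False
  obtain i where i: "i \<in> A" using A by fastforce
  then have "(x i)\<^sup>2 \<le> 1\<^sup>2" using False by force
  then have "\<bar>x i\<bar> \<le> 1" by (metis abs_le_square_iff abs_one)
  then have "\<bar>x i\<bar> / (800 * real K) \<le> 1" using A(3) by (simp add: divide_le_eq)
  then have "\<bar>sum x A\<bar> \<le> 1" using small[OF i] by linarith
  then show ?thesis using balanced_log_sum[OF A unit _ _ nz N] False by force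
qed

text \<open>
  The normalisation \<open>Q = 1\<close> of the previous lemmas is removed by scaling.  The smallness condition is
  relative to the size of the terms, so it is invariant under scaling.
\<close>

lemma log_sum_le:
  fixes x :: "'a \<Rightarrow> real"
  assumes A: "finite A" "card A = K" "K \<ge> 8"
    and small: "\<And>i. i \<in> A \<Longrightarrow> \<bar>sum x A\<bar> \<le> \<bar>x i\<bar> / (800 * real K)"
    and nz: "\<And>I. I \<subseteq> A \<Longrightarrow> signed_sum x A I \<noteq> 0"
    and N: "N = 2 ^ (K - 1) - 1"
  shows "(\<Sum>I\<in>Pow A - {A, {}}. ln ((signed_sum x A I)\<^sup>2))
     \<le> 2 * N * ln (\<Sum>i\<in>A. (x i)\<^sup>2) + 2 - 2 / N - 4 * N / real K"
proof -
  define \<sigma> where "\<sigma> = sqrt (\<Sum>i\<in>A. (x i)\<^sup>2)"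
  define y where "y i = x i / \<sigma>" for i
  have "(\<Sum>i\<in>A. (x i)\<^sup>2) \<noteq> 0"
  proof
    assume "(\<Sum>i\<in>A. (x i)\<^sup>2) = 0"
    then have "\<forall>i\<in>A. (x i)\<^sup>2 = 0" using A(1) by (subst (asm) sum_nonneg_eq_0_iff) auto
    then have "sum x A = 0" by simp
    then show False using nz[of A] by (simp add: signed_sum_full)
  qed
  then have sq: "(\<Sum>i\<in>A. (x i)\<^sup>2) > 0" by (simp add: sum_nonneg less_le)
  then have \<sigma>: "\<sigma> > 0" "\<sigma>\<^sup>2 = (\<Sum>i\<in>A. (x i)\<^sup>2)" by (auto simp: \<sigma>_def)
  have s: "signed_sum y A I = signed_sum x A I / \<sigma>" for I
    by (auto simp: signed_sum_def y_def sum_divide_distrib intro!: sum.cong)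
  have S: "sum y A = sum x A / \<sigma>" by (simp add: y_def sum_divide_distrib)
  have "(\<Sum>I\<in>Pow A - {A, {}}. ln ((signed_sum y A I)\<^sup>2)) \<le> 2 - 2 / N - 4 * N / real K"
  proof (rule log_sum_le_if_unit[OF A _ _ _ N])
    show "(\<Sum>i\<in>A. (y i)\<^sup>2) = 1"
      using \<sigma> sq by (simp add: y_def power_divide flip: sum_divide_distrib)
    show "\<bar>sum y A\<bar> \<le> \<bar>y i\<bar> / (800 * real K)" if "i \<in> A" for i
    proof -
      have "\<bar>sum y A\<bar> = \<bar>sum x A\<bar> / \<sigma>" using \<sigma>(1) by (simp add: S)
      also have "\<dots> \<le> \<bar>x i\<bar> / (800 * real K) / \<sigma>"
        using small[OF that] \<sigma>(1) by (intro divide_right_mono) auto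
      also have "\<dots> = \<bar>y i\<bar> / (800 * real K)" using \<sigma>(1) by (simp add: y_def)
      finally show ?thesis .
    qed
    show "signed_sum y A I \<noteq> 0" if "I \<subseteq> A" for I
      using nz[OF that] \<sigma> by (simp add: s)
  qed
  moreover have "ln ((signed_sum y A I)\<^sup>2) = ln ((signed_sum x A I)\<^sup>2) - ln (\<sigma>\<^sup>2)"
    if "I \<subseteq> A" for I
  proof -
    have "signed_sum x A I \<noteq> 0" using nz[OF that] .
    then show ?thesis
      unfolding s power_divide using \<sigma>(1) by (intro ln_divide_pos) auto
  qed
  then have "(\<Sum>I\<in>Pow A - {A, {}}. ln ((signed_sum y A I)\<^sup>2))
      = (\<Sum>I\<in>Pow A - {A, {}}. ln ((signed_sum x A I)\<^sup>2) - ln (\<sigma>\<^sup>2))"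
    by (intro sum.cong) auto
  moreover have "real (card (Pow A - {A, {}})) = 2 * N"
  proof -
    have "A \<noteq> {}" using A by auto
    then have "card (Pow A - {A, {}}) = 2 ^ K - 2"
      using A by (subst card_Diff_subset) (auto simp: card_Pow)
    moreover have "(2::nat) ^ K = 2 * 2 ^ (K - 1)" using A(3) by (cases K) auto
    moreover have "(1::nat) \<le> 2 ^ (K - 1)" by simp
    ultimately have "card (Pow A - {A, {}}) = 2 * (2 ^ (K - 1) - 1)" by simp
    then show ?thesis using N by (simp add: of_nat_diff)
  qed
  ultimately show ?thesis unfolding sum_subtractf \<sigma>(2) by simp
qed

section \<open>Lower bound for the full sum\<close>

text \<open>
  Take logarithms in \<open>1 \<le> (\<Prod> s\<^sub>I)\<^sup>2\<close> and insert the bound on the factors other than the two equal to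
  \<open>\<plusminus> sum x A\<close>.  The constant \<open>2 - 2 / N\<close> left over there is what the factor \<open>1 + 1 / N\<close> absorbs, by
  \<open>N ln (1 + 1 / N) \<ge> 1 - 1 / N\<close>.
\<close>

lemma sum_lower_bound:
  fixes x :: "'a \<Rightarrow> real"
  assumes A: "finite A" "card A = K" "K \<ge> 8"
    and int: "\<And>i. i \<in> A \<Longrightarrow> (x i)\<^sup>2 \<in> \<int>"
    and x1: "\<And>i. i \<in> A \<Longrightarrow> \<bar>x i\<bar> \<ge> 1"
    and nz: "\<And>I. I \<subseteq> A \<Longrightarrow> signed_sum x A I \<noteq> 0"
    and small: "\<bar>sum x A\<bar> \<le> 1 / (800 * real K)"
    and N: "N = 2 ^ (K - 1) - 1"
  shows "exp (N / real K) * ((1 + 1 / N) * (\<Sum>i\<in>A. (x i)\<^sup>2)) powr (- (N / 2)) \<le> \<bar>sum x A\<bar>"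
proof -
  define Q where "Q = (\<Sum>i\<in>A. (x i)\<^sup>2)"
  define S where "S = sum x A"
  have "A \<noteq> {}" using A by auto
  have S: "S \<noteq> 0" using nz[of A] by (simp add: S_def signed_sum_full)
  have "(2::real) ^ 1 \<le> 2 ^ (K - 1)" using A(3) by (intro power_increasing) auto
  then have N1: "N \<ge> 1" using N by simp
  have "Q > 0"
    unfolding Q_def using A \<open>A \<noteq> {}\<close> x1 by (intro sum_pos) force+
  have "(\<Prod>I\<in>Pow A. signed_sum x A I) \<in> \<int>"
    using prod_signed_sums_in_Ints[of A x] A int by blast
  moreover have "(\<Prod>I\<in>Pow A. signed_sum x A I) \<noteq> 0"
    using A nz by simp
  ultimately have "1 \<le> \<bar>\<Prod>I\<in>Pow A. signed_sum x A I\<bar>"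
    by (rule Ints_nonzero_abs_ge1)
  then have "1 \<le> (\<Prod>I\<in>Pow A. signed_sum x A I)\<^sup>2"
    by (metis abs_le_square_iff abs_one one_power2)
  then have "0 \<le> ln (\<Prod>I\<in>Pow A. (signed_sum x A I)\<^sup>2)"
    by (simp add: prod_power_distrib)
  also have "\<dots> = (\<Sum>I\<in>Pow A. ln ((signed_sum x A I)\<^sup>2))"
    using A nz by (intro ln_prod) auto
  also have "\<dots> = (\<Sum>I\<in>Pow A - {A, {}}. ln ((signed_sum x A I)\<^sup>2)) + (\<Sum>I\<in>{A, {}}. ln ((signed_sum x A I)\<^sup>2))"
    using A by (intro sum.subset_diff) auto
  also have "(\<Sum>I\<in>{A, {}}. ln ((signed_sum x A I)\<^sup>2)) = 2 * ln (S\<^sup>2)"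
    using \<open>A \<noteq> {}\<close> by (simp add: signed_sum_full signed_sum_none S_def)
  also have "ln (S\<^sup>2) = 2 * ln \<bar>S\<bar>"
    using S ln_realpow[of "\<bar>S\<bar>" 2] by simp
  also have "(\<Sum>I\<in>Pow A - {A, {}}. ln ((signed_sum x A I)\<^sup>2)) \<le> 2 * N * ln Q + 2 - 2 / N - 4 * N / real K"
    unfolding Q_def
  proof (rule log_sum_le[OF A _ nz N])
    fix i assume "i \<in> A"
    then have "1 / (800 * real K) \<le> \<bar>x i\<bar> / (800 * real K)"
      using x1 by (intro divide_right_mono) auto
    then show "\<bar>sum x A\<bar> \<le> \<bar>x i\<bar> / (800 * real K)" using small by linarith
  qed
  finally have lnS: "N / real K - N / 2 * ln Q - (1 / 2 - 1 / N / 2) \<le> ln \<bar>S\<bar>"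
    by simp
  have "1 / N - (1 / N)\<^sup>2 \<le> ln (1 + 1 / N)"
    using N1 by (intro ln_one_plus_pos_lower_bound) auto
  then have "N / 2 * (1 / N - (1 / N)\<^sup>2) \<le> N / 2 * ln (1 + 1 / N)"
    using N1 by (intro mult_left_mono) auto
  also have "N / 2 * (1 / N - (1 / N)\<^sup>2) = 1 / 2 - 1 / N / 2"
    using N1 by (simp add: power2_eq_square field_simps)
  finally have "N / real K - N / 2 * (ln (1 + 1 / N) + ln Q) \<le> ln \<bar>S\<bar>"
    using lnS by (simp add: algebra_simps)
  moreover have "ln ((1 + 1 / N) * Q) = ln (1 + 1 / N) + ln Q"
    using N1 \<open>Q > 0\<close> by (intro ln_mult_pos) (auto intro: add_pos_pos)
  moreover have pos: "(1 + 1 / N) * Q > 0"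
    using N1 \<open>Q > 0\<close> by (intro mult_pos_pos add_pos_pos) auto
  ultimately have "exp (N / real K + - (N / 2) * ln ((1 + 1 / N) * Q)) \<le> exp (ln \<bar>S\<bar>)"
    by simp
  also have "exp (ln \<bar>S\<bar>) = \<bar>S\<bar>" using S by simp
  also have "exp (N / real K + - (N / 2) * ln ((1 + 1 / N) * Q))
      = exp (N / real K) * ((1 + 1 / N) * Q) powr (- (N / 2))"
    using pos unfolding exp_add powr_def by auto
  finally show ?thesis by (simp only: Q_def S_def)
qed

text \<open>
  This justifies the smallness assumption of the previous lemma: when it fails, the bound holds for
  trivial reasons.
\<close>

lemma bound_is_tiny:
  fixes N Q :: real
  assumes K: "K \<ge> 8" and N: "N = 2 ^ (K - 1) - 1" and Q: "Q \<ge> 8"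
  shows "exp (N / real K) * Q powr (- (N / 2)) \<le> 1 / (800 * real K)"
proof -
  have "real (126 * K\<^sup>2 + 128) \<le> real (64 * 2 ^ (K - 1))"
    using power_dominates_square[OF K] of_nat_le_iff by blast
  then have "126 * (real K * real K) + 128 \<le> 64 * 2 ^ (K - 1)"
    by (simp add: power2_eq_square)
  moreover have "8 * real K \<le> real K * real K" using K by (intro mult_right_mono) auto
  ultimately have N15: "N \<ge> 15 * real K" unfolding N using K by linarith
  then have N120: "N \<ge> 120" using K by simp
  have "N / real K \<le> N / 8" using N120 K by (intro divide_left_mono) auto
  moreover have "ln Q \<ge> 2"
  proof -
    have "ln (8::real) = 3 * ln 2" using ln_realpow[of 2 3] by simp
    moreover have "ln 8 \<le> ln Q" using Q by simp
    ultimately show ?thesis using ln2_ge_two_thirds by linarith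
  qed
  then have "N / 2 * 2 \<le> N / 2 * ln Q" using N120 by (intro mult_left_mono) auto
  ultimately have "N / real K - N / 2 * ln Q \<le> - (N / 2)"
    using N120 by linarith
  then have "exp (N / real K - N / 2 * ln Q) \<le> exp (- (N / 2))" by simp
  also have "\<dots> = 1 / exp (N / 8) ^ 4"
    by (simp add: exp_minus inverse_eq_divide flip: exp_of_nat_mult)
  also have "\<dots> \<le> 1 / (800 * real K)"
  proof (rule divide_left_mono)
    have "800 * real K \<le> 15 ^ 3 * (15 * real K / 8)" using K by simp
    also have "\<dots> \<le> (N / 8) ^ 3 * (N / 8)"
      using N15 N120 K by (intro mult_mono power_mono) auto
    also have "\<dots> = (N / 8) ^ 4" by (simp add: eval_nat_numeral)
    also have "\<dots> \<le> exp (N / 8) ^ 4"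
      using N120 exp_ge_add_one_self[of "N / 8"] by (intro power_mono) linarith+
    finally show "800 * real K \<le> exp (N / 8) ^ 4" .
  qed (use K in auto)
  finally have "exp (N / real K - N / 2 * ln Q) \<le> 1 / (800 * real K)" .
  moreover have "exp (N / real K - N / 2 * ln Q) = exp (N / real K) * Q powr (- (N / 2))"
    using Q unfolding diff_conv_add_uminus exp_add powr_def by simp
  ultimately show ?thesis by simp
qed

section \<open>The constant, and the theorem\<close>

lemma two_powr_one_minus:
  assumes "K \<ge> 1"
  shows "2 powr (1 - real K) = 1 / 2 ^ (K - 1)"
proof -
  have "1 - real K = - real (K - 1)" using assms by (simp add: of_nat_diff)
  then show ?thesis by (simp add: powr_minus powr_realpow inverse_eq_divide del: of_nat_diff)
qed

lemma C_const_eq: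
  assumes K: "K \<ge> 8" and N: "N = 2 ^ (K - 1) - 1"
  shows "C_const K = (1 + 1 / N) powr (- (N / 2))"
proof -
  have "(2::real) ^ 1 \<le> 2 ^ (K - 1)" using K by (intro power_increasing) auto
  then have N1: "N \<ge> 1" using N by simp
  have e: "(2::real) ^ (K - 1) = N + 1" using N by simp
  have "1 - 2 powr (1 - real K) = 1 - 1 / (N + 1)"
    using K two_powr_one_minus[of K] e by simp
  also have "\<dots> = inverse (1 + 1 / N)"
    using N1 by (simp add: field_simps)
  finally have "C_const K = inverse (1 + 1 / N) powr (N / 2)"
    unfolding C_const_def e by simp
  moreover have "1 + 1 / N > 0" using N1 by (intro add_pos_pos) auto
  ultimately show ?thesis by (simp add: powr_minus inverse_powr)
qed

lemma C_const_gt: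
  assumes "K \<ge> 8"
  shows "C_const K > exp (- 1 / 2)"
proof -
  define N :: real where "N = 2 ^ (K - 1) - 1"
  have "(2::real) ^ 1 \<le> 2 ^ (K - 1)" using assms by (intro power_increasing) auto
  then have N1: "N \<ge> 1" by (simp add: N_def)
  have "ln (1 + 1 / N) < 1 / N" using N1 by (intro ln_add_one_self_less_self) auto
  then have "N / 2 * ln (1 + 1 / N) < N / 2 * (1 / N)"
    using N1 by (intro mult_strict_left_mono) auto
  then have "- 1 / 2 < - (N / 2) * ln (1 + 1 / N)" using N1 by simp
  then have "exp (- 1 / 2) < exp (- (N / 2) * ln (1 + 1 / N))" by (subst exp_less_cancel_iff)
  moreover have "1 + 1 / N > 0" using N1 by (intro add_pos_pos) auto
  ultimately show ?thesis
    using C_const_eq[OF assms N_def] by (simp add: powr_def)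
qed

lemma C_const_diff_le:
  assumes "K \<ge> 8"
  shows "C_const K - exp (- 1 / 2) \<le> 4 * 2 powr (- real K)"
proof -
  define N :: real where "N = 2 ^ (K - 1) - 1"
  have "(2::real) ^ 1 \<le> 2 ^ (K - 1)" using assms by (intro power_increasing) auto
  then have N1: "N \<ge> 1" and N2: "2 ^ (K - 1) \<le> 2 * N" by (auto simp: N_def)
  have "1 / N - (1 / N)\<^sup>2 \<le> ln (1 + 1 / N)"
    using N1 by (intro ln_one_plus_pos_lower_bound) auto
  then have "N / 2 * (1 / N - (1 / N)\<^sup>2) \<le> N / 2 * ln (1 + 1 / N)"
    using N1 by (intro mult_left_mono) auto
  also have "N / 2 * (1 / N - (1 / N)\<^sup>2) = 1 / 2 - 1 / N / 2"
    using N1 by (simp add: power2_eq_square field_simps)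
  finally have "- (N / 2) * ln (1 + 1 / N) \<le> - 1 / 2 + 1 / N / 2" by simp
  moreover have pos: "1 + 1 / N > 0" using N1 by (intro add_pos_pos) auto
  ultimately have C: "C_const K \<le> exp (- 1 / 2 + 1 / N / 2)"
    using C_const_eq[OF assms N_def] by (simp add: powr_def)
  define u where "u = 1 / N / 2"
  have u: "0 \<le> u" "u \<le> 1 / 2" using N1 by (auto simp: u_def field_simps)
  have "exp u * (1 - u) \<le> exp u * exp (- u)"
    using exp_ge_add_one_self[of "- u"] by (intro mult_left_mono) auto
  then have "exp u * (1 - u) \<le> 1" by (simp flip: exp_add)
  moreover have "exp u * (1 / 2) \<le> exp u * (1 - u)" using u by (intro mult_left_mono) auto
  ultimately have "exp u \<le> 2" by linarith
  then have "exp u * u \<le> 2 * u" using u by (intro mult_right_mono) auto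
  then have "exp u - 1 \<le> 2 * u" using \<open>exp u * (1 - u) \<le> 1\<close> by (simp add: algebra_simps)
  have "C_const K - exp (- 1 / 2) \<le> exp (- 1 / 2) * (exp u - 1)"
    using C unfolding u_def[symmetric] exp_add by (simp add: right_diff_distrib)
  also have "\<dots> \<le> 1 * (2 * u)"
    using \<open>exp u - 1 \<le> 2 * u\<close> u by (intro mult_mono) auto
  also have "\<dots> = 1 / N" by (simp add: u_def)
  also have "\<dots> \<le> 1 / (2 ^ (K - 1) / 2)" using N1 N2 by (intro divide_left_mono) auto
  also have "\<dots> = 4 * 2 powr (- real K)"
  proof -
    have "2 powr (- real K) = 1 / 2 ^ K" by (simp add: powr_minus powr_realpow inverse_eq_divide)
    moreover have "(2::real) ^ K = 2 * 2 ^ (K - 1)" using assms by (cases K) auto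
    ultimately show ?thesis by simp
  qed
  finally show ?thesis .
qed

theorem theorem1p1:
  shows "(\<forall>(K::nat) (a :: nat \<Rightarrow> nat) (m :: nat \<Rightarrow> int).
            K \<ge> 8 \<longrightarrow>
            (\<forall>n\<in>{1..K}. a n > 0) \<longrightarrow>
            inj_on (\<lambda>n. squarefree_part (a n)) {1..K} \<longrightarrow>
            (\<forall>n\<in>{1..K}. m n \<noteq> 0) \<longrightarrow>
              Lambda K m a \<ge>
                exp ((2 ^ (K - 1) - 1) / real K) *
                (1 / (1 - 2 powr (1 - real K)) * (\<Sum>n=1..K. (real_of_int (m n))\<^sup>2 * real (a n)))
                  powr (- ((2 ^ (K - 1) - 1) / 2))
            \<and> Lambda K m a \<ge>
                C_const K * exp ((2 ^ (K - 1) - 1) / real K) *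
                ((MAX n\<in>{1..K}. \<bar>real_of_int (m n)\<bar> * sqrt (real (a n))) * sqrt (real K))
                  powr (- (2 ^ (K - 1) - 1)))
       \<and> (\<forall>K\<ge>8. C_const K > exp (- 1 / 2))
       \<and> (\<exists>c::real. \<forall>K\<ge>8. \<bar>C_const K - exp (- 1 / 2)\<bar> \<le> c * 2 powr (- real K))"
proof (intro conjI allI impI)
  fix K :: nat and a :: "nat \<Rightarrow> nat" and m :: "nat \<Rightarrow> int"
  assume K: "K \<ge> 8" and a: "\<forall>n\<in>{1..K}. a n > 0"
    and sf: "inj_on (\<lambda>n. squarefree_part (a n)) {1..K}" and m: "\<forall>n\<in>{1..K}. m n \<noteq> 0"
  define N :: real where "N = 2 ^ (K - 1) - 1"
  define x where "x n = real_of_int (m n) * sqrt (real (a n))" for n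
  define Q where "Q = (\<Sum>n=1..K. (x n)\<^sup>2)"
  have "(2::real) ^ 1 \<le> 2 ^ (K - 1)" using K by (intro power_increasing) auto
  then have N1: "N \<ge> 1" by (simp add: N_def)
  have base: "1 / (1 - 2 powr (1 - real K)) = 1 + 1 / N"
  proof -
    have "2 powr (1 - real K) = 1 / (N + 1)" using K two_powr_one_minus[of K] by (simp add: N_def)
    then show ?thesis using N1 by (simp only:) (simp add: field_simps)
  qed
  have xsq: "(x n)\<^sup>2 = (real_of_int (m n))\<^sup>2 * real (a n)" for n
    by (simp add: x_def power_mult_distrib)
  have x_int: "(x n)\<^sup>2 \<in> \<int>" for n by (simp add: xsq)
  have x1: "1 \<le> \<bar>x n\<bar>" if "n \<in> {1..K}" for n
  proof -
    have "x n \<noteq> 0" using a m that by (auto simp: x_def)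
    then have "1 \<le> \<bar>(x n)\<^sup>2\<bar>" using x_int by (intro Ints_nonzero_abs_ge1) auto
    then have "1\<^sup>2 \<le> (x n)\<^sup>2" by simp
    then show ?thesis by (metis abs_le_square_iff abs_one)
  qed
  have nz: "signed_sum x {1..K} I \<noteq> 0" for I
  proof
    define c where "c n = (if n \<in> I then real_of_int (m n) else - real_of_int (m n))" for n
    assume "signed_sum x {1..K} I = 0"
    then have "(\<Sum>n=1..K. c n * sqrt (real (a n))) = 0"
      unfolding signed_sum_def by (subst sum.cong[OF refl, of _ _ "\<lambda>n. if n \<in> I then x n else - x n"])
        (auto simp: c_def x_def)
    then have "\<forall>n\<in>{1..K}. c n = 0"
      using a sf by (intro sqrt_distinct_squarefree_parts_independent) (auto simp: c_def)
    then have "c 1 = 0" using K by simp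
    moreover have "m 1 \<noteq> 0" using m K by simp
    ultimately show False by (simp add: c_def split: if_splits)
  qed
  have Lambda: "Lambda K m a = \<bar>sum x {1..K}\<bar>" by (simp add: Lambda_def x_def)
  have "real (card {1..K}) * 1 \<le> Q"
    unfolding Q_def
  proof (rule sum_bounded_below)
    show "1 \<le> (x n)\<^sup>2" if "n \<in> {1..K}" for n
      using x1[OF that] by (metis abs_le_square_iff abs_one one_power2)
  qed
  then have "Q \<ge> 8" using K by simp
  have main: "exp (N / real K) * ((1 + 1 / N) * Q) powr (- (N / 2)) \<le> Lambda K m a"
  proof (cases "\<bar>sum x {1..K}\<bar> \<le> 1 / (800 * real K)")
    case True
    then show ?thesis unfolding Lambda Q_def
      using K x_int x1 nz by (intro sum_lower_bound) (auto simp: N_def)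
  next
    case False
    have "1 * Q \<le> (1 + 1 / N) * Q" using N1 \<open>Q \<ge> 8\<close> by (intro mult_right_mono) auto
    then have "exp (N / real K) * ((1 + 1 / N) * Q) powr (- (N / 2)) \<le> 1 / (800 * real K)"
      using \<open>Q \<ge> 8\<close> by (intro bound_is_tiny[OF K N_def]) linarith
    then show ?thesis using False Lambda by linarith
  qed
  then show "exp ((2 ^ (K - 1) - 1) / real K) *
      (1 / (1 - 2 powr (1 - real K)) * (\<Sum>n=1..K. (real_of_int (m n))\<^sup>2 * real (a n)))
        powr (- ((2 ^ (K - 1) - 1) / 2)) \<le> Lambda K m a"
    unfolding base Q_def xsq N_def .
  define M where "M = (MAX n\<in>{1..K}. \<bar>real_of_int (m n)\<bar> * sqrt (real (a n)))"
  have M: "\<bar>x n\<bar> \<le> M" if "n \<in> {1..K}" for n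
  proof -
    have "\<bar>x n\<bar> = \<bar>real_of_int (m n)\<bar> * sqrt (real (a n))" by (simp add: x_def abs_mult)
    then show ?thesis unfolding M_def using that by (intro Max_ge) auto
  qed
  have M1: "M \<ge> 1" using M[of 1] x1[of 1] K by simp
  have "Q \<le> real (card {1..K}) * M\<^sup>2"
    unfolding Q_def
  proof (rule sum_bounded_above)
    show "(x n)\<^sup>2 \<le> M\<^sup>2" if "n \<in> {1..K}" for n
      using M[OF that] M1 by (simp add: abs_le_square_iff[symmetric])
  qed
  then have Q: "Q \<le> (M * sqrt (real K))\<^sup>2" by (simp add: power_mult_distrib mult.commute)
  have MK: "M * sqrt (real K) > 0" using M1 K by simp
  have N': "1 + 1 / N > 0" using N1 by (intro add_pos_pos) auto
  have "C_const K * exp (N / real K) * (M * sqrt (real K)) powr (- N)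
      = exp (N / real K) * ((1 + 1 / N) * (M * sqrt (real K))\<^sup>2) powr (- (N / 2))"
  proof -
    have "(M * sqrt (real K))\<^sup>2 powr (- (N / 2)) = (M * sqrt (real K)) powr (- N)"
      using MK by (simp add: powr_powr flip: powr_numeral)
    then show ?thesis
      using N' C_const_eq[OF K N_def] by (simp add: powr_mult)
  qed
  also have "\<dots> \<le> exp (N / real K) * ((1 + 1 / N) * Q) powr (- (N / 2))"
    using Q \<open>Q \<ge> 8\<close> N1 N' by (intro mult_left_mono powr_mono2') auto
  also note main
  finally show "C_const K * exp ((2 ^ (K - 1) - 1) / real K) *
      ((MAX n\<in>{1..K}. \<bar>real_of_int (m n)\<bar> * sqrt (real (a n))) * sqrt (real K))
        powr (- (2 ^ (K - 1) - 1)) \<le> Lambda K m a"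
    unfolding M_def N_def .
next
  show "exp (- 1 / 2) < C_const K" if "K \<ge> 8" for K using C_const_gt[OF that] .
next
  show "\<exists>c::real. \<forall>K\<ge>8. \<bar>C_const K - exp (- 1 / 2)\<bar> \<le> c * 2 powr (- real K)"
    using C_const_diff_le C_const_gt by (intro exI[of _ 4]) fastforce
qed

end
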